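(* Let $(G,d)$ be a group with a two-sided invariant metric and $A\le G$ a closed subgroup. Let $\langle t\rangle\cong\mathbb Z$ with metric $d(t^m,t^n)=|m-n|$, and let $d$ also denote the Graev metric on the free product $G*\langle t\rangle$. The subgroup of $G*\langle t\rangle$ generated by $G$ and $tAt^{-1}$ is (as an abstract group) the free product $G*tAt^{-1}$; equip $tAt^{-1}$ with the metric $d(ta_1t^{-1},ta_2t^{-1})=d(a_1,a_2)$ and let $\underline d$ be the Graev metric on the free product $(G,d)*(tAt^{-1},d)$. Then $d|_{G*tAt^{-1}}=\underline d$ if and only if $\operatorname{diam}_d(A)\le 1$.
   Context: Graev metric on a free product (amalgamation over the trivial group): for groups $(H_1,d_1),(H_2,d_2)$ with two-sided invariant metrics, let $H=H_1\cup H_2$ (with $H_1\cap H_2=\{e\}$) carry the metric equal to $d_i$ on $H_i$ and $d(h_1,h_2)=d_1(h_1,e)+d_2(e,h_2)$ for $h_1\in H_1$, $h_2\in H_2$. For words $\alpha$ over the alphabet $H$, $\hat\alpha$ is the product of its letters in $H_1*H_2$. The Graev metric is $\underline d(f_1,f_2)=\inf\{\sum_i d(\alpha_1(i),\alpha_2(i)):|\alpha_1|=|\alpha_2|,\ \hat\alpha_1=f_1,\ \hat\alpha_2=f_2\}$, a two-sided invariant metric on $H_1*H_2$ extending $d_1,d_2$. $\operatorname{diam}_d(A)=\sup\{d(a_1,a_2):a_1,a_2\in A\}$. *)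

theory Defs
  imports "HOL-Algebra.Elementary_Groups" "HOL-Library.Extended_Real"
begin

definition inv_metric :: "('a,'m) monoid_scheme \<Rightarrow> ('a \<Rightarrow> 'a \<Rightarrow> real) \<Rightarrow> bool" where
  "inv_metric G d \<longleftrightarrow>
     (\<forall>x\<in>carrier G. \<forall>y\<in>carrier G. d x y \<ge> 0 \<and> (d x y = 0 \<longleftrightarrow> x = y) \<and> d x y = d y x) \<and>
     (\<forall>x\<in>carrier G. \<forall>y\<in>carrier G. \<forall>z\<in>carrier G. d x z \<le> d x y + d y z) \<and>
     (\<forall>g\<in>carrier G. \<forall>x\<in>carrier G. \<forall>y\<in>carrier G.
        d (g \<otimes>\<^bsub>G\<^esub> x) (g \<otimes>\<^bsub>G\<^esub> y) = d x y \<and> d (x \<otimes>\<^bsub>G\<^esub> g) (y \<otimes>\<^bsub>G\<^esub> g) = d x y)"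

definition metric_closed :: "('a,'m) monoid_scheme \<Rightarrow> ('a \<Rightarrow> 'a \<Rightarrow> real) \<Rightarrow> 'a set \<Rightarrow> bool" where
  "metric_closed G d A \<longleftrightarrow>
     (\<forall>g\<in>carrier G. (\<forall>e>0. \<exists>a\<in>A. d a g < e) \<longrightarrow> g \<in> A)"

definition diam :: "('a \<Rightarrow> 'a \<Rightarrow> real) \<Rightarrow> 'a set \<Rightarrow> ereal" where
  "diam d A = (SUP a1\<in>A. SUP a2\<in>A. ereal (d a1 a2))"

text \<open>Letters: Inl h for h in H1, Inr h for h in H2 (the two identities are both
  letters; they evaluate to the identity and are at distance 0 from each other).\<close>

definition letters :: "('a,'m) monoid_scheme \<Rightarrow> ('b,'n) monoid_scheme \<Rightarrow> ('a + 'b) set" where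
  "letters H1 H2 = Inl ` carrier H1 \<union> Inr ` carrier H2"

fun fp_cons :: "('a,'m) monoid_scheme \<Rightarrow> ('b,'n) monoid_scheme \<Rightarrow> ('a + 'b) \<Rightarrow> ('a + 'b) list \<Rightarrow> ('a + 'b) list" where
  "fp_cons H1 H2 (Inl a) w =
     (if a = \<one>\<^bsub>H1\<^esub> then w else
      (case w of
         Inl b # w' \<Rightarrow> (if a \<otimes>\<^bsub>H1\<^esub> b = \<one>\<^bsub>H1\<^esub> then w' else Inl (a \<otimes>\<^bsub>H1\<^esub> b) # w')
       | _ \<Rightarrow> Inl a # w))"
| "fp_cons H1 H2 (Inr a) w =
     (if a = \<one>\<^bsub>H2\<^esub> then w else
      (case w of
         Inr b # w' \<Rightarrow> (if a \<otimes>\<^bsub>H2\<^esub> b = \<one>\<^bsub>H2\<^esub> then w' else Inr (a \<otimes>\<^bsub>H2\<^esub> b) # w')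
       | _ \<Rightarrow> Inr a # w))"

text \<open>The product \<open>\<alpha>^\<close> of a word in \<open>H1 * H2\<close>, represented by its reduced normal form.\<close>
definition fp_eval :: "('a,'m) monoid_scheme \<Rightarrow> ('b,'n) monoid_scheme \<Rightarrow> ('a + 'b) list \<Rightarrow> ('a + 'b) list" where
  "fp_eval H1 H2 ws = foldr (fp_cons H1 H2) ws []"

text \<open>Elements of the free product \<open>H1 * H2\<close>: reduced words.\<close>
definition fp_carrier :: "('a,'m) monoid_scheme \<Rightarrow> ('b,'n) monoid_scheme \<Rightarrow> ('a + 'b) list set" where
  "fp_carrier H1 H2 = {w. set w \<subseteq> letters H1 H2 \<and> fp_eval H1 H2 w = w}"

fun letter_dist :: "('a,'m) monoid_scheme \<Rightarrow> ('b,'n) monoid_scheme \<Rightarrow>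
    ('a \<Rightarrow> 'a \<Rightarrow> real) \<Rightarrow> ('b \<Rightarrow> 'b \<Rightarrow> real) \<Rightarrow> ('a + 'b) \<Rightarrow> ('a + 'b) \<Rightarrow> real" where
  "letter_dist H1 H2 d1 d2 (Inl a) (Inl b) = d1 a b"
| "letter_dist H1 H2 d1 d2 (Inr a) (Inr b) = d2 a b"
| "letter_dist H1 H2 d1 d2 (Inl a) (Inr b) = d1 a \<one>\<^bsub>H1\<^esub> + d2 \<one>\<^bsub>H2\<^esub> b"
| "letter_dist H1 H2 d1 d2 (Inr b) (Inl a) = d1 a \<one>\<^bsub>H1\<^esub> + d2 \<one>\<^bsub>H2\<^esub> b"

definition graev :: "('a,'m) monoid_scheme \<Rightarrow> ('b,'n) monoid_scheme \<Rightarrow>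
    ('a \<Rightarrow> 'a \<Rightarrow> real) \<Rightarrow> ('b \<Rightarrow> 'b \<Rightarrow> real) \<Rightarrow> ('a + 'b) list \<Rightarrow> ('a + 'b) list \<Rightarrow> real" where
  "graev H1 H2 d1 d2 f1 f2 = Inf
     {(\<Sum>i<length \<alpha>1. letter_dist H1 H2 d1 d2 (\<alpha>1 ! i) (\<alpha>2 ! i)) | \<alpha>1 \<alpha>2.
        length \<alpha>1 = length \<alpha>2 \<and> set \<alpha>1 \<subseteq> letters H1 H2 \<and> set \<alpha>2 \<subseteq> letters H1 H2 \<and>
        fp_eval H1 H2 \<alpha>1 = f1 \<and> fp_eval H1 H2 \<alpha>2 = f2}"

text \<open>\<open>\<langle>t\<rangle>\<close> is the integer group, \<open>t^n\<close> corresponding to \<open>n\<close>; a letter \<open>Inr a\<close>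
  (a \<in> A) of \<open>G * tAt\<inverse>\<close> stands for \<open>t a t\<inverse>\<close>.\<close>
definition conj_embed :: "('a,'m) monoid_scheme \<Rightarrow> ('a + 'a) list \<Rightarrow> ('a + int) list" where
  "conj_embed G w = fp_eval G integer_group
     (concat (map (\<lambda>x. case x of Inl g \<Rightarrow> [Inl g] | Inr a \<Rightarrow> [Inr 1, Inl a, Inr (-1)]) w))"

definition int_dist :: "int \<Rightarrow> int \<Rightarrow> real" where
  "int_dist m n = real_of_int \<bar>m - n\<bar>"

end

(*
  A Graev approximation in G * <t> of a word over G and t, t^-1 is a noncrossing matching: some letters
  t^e are cancelled in pairs, the others are deleted at cost 1 each, and the elements of G that come
  to lie in a common region are multiplied together. The cheapest contraction does not get more
  expensive when a word is freely reduced, so it suffices to contract the word read off from an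
  element of G * tAt^-1. There the letters t alternate between G and the conjugate of A; a region
  without deleted letters contains letters of only one of the two factors and contracts equally well
  in G * tAt^-1, while a region with 2p deleted letters contains p blocks from A, and 2p is just
  enough to delete each of them from both the word and the product, if diam A <= 1. Conversely,
  a and tat^-1 have distance at most 2 in G * <t>, but 2 d(a,1) in G * tAt^-1.
*)

theory Submission
  imports Defs
begin

section \<open>Free products as groups of words\<close>

text \<open>The Graev infimum in G * <t> ranges over words unrelated to the subgroup, so two-sided
  invariance is used to pass to the single element \<open>f2^-1 f1\<close>, whose normal form does
  show the factors G and tAt^-1. Contractions are built from the right end, so the induction meets
  regions cut off in the middle. Such a region may start in either factor, and its product
  \<open>g\<close> may be any element of G even where all letters come from A, because changing
  letters at a cost changes the value. The invariant therefore puts unknown elements of A at the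
  ends in the conjugate factor and keeps a budget in reserve: \<open>d a g\<close> while a region in
  the conjugate factor has no deleted letter, and otherwise 1 for each end in that factor. A reserve
  of 1 and the next deleted letter make up the 2 that suffices to move an element of A into G, where
  the letter distance is d(a,1) + d(1,a). The lower bound 2 d(a,1) of the converse comes from the
  homomorphism to G x A, which separates the two copies of \<open>a\<close>.\<close>

locale free_product = H1: group H1 + H2: group H2
  for H1 :: "('a, 'm) monoid_scheme" and H2 :: "('b, 'n) monoid_scheme"
begin

abbreviation L where "L \<equiv> letters H1 H2"
abbreviation ev where "ev \<equiv> fp_eval H1 H2"

text \<open>The structural form of the fixed points of \<open>ev\<close>; unlike the equation
  \<open>ev w = w\<close> it can be checked letter by letter.\<close>

definition reduced :: "('a + 'b) list \<Rightarrow> bool" where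
  "reduced w \<longleftrightarrow> set w \<subseteq> L - {Inl \<one>\<^bsub>H1\<^esub>, Inr \<one>\<^bsub>H2\<^esub>} \<and> successively (\<lambda>x y. isl x \<noteq> isl y) w"

lemma Inl_in_L [simp]: "Inl a \<in> L \<longleftrightarrow> a \<in> carrier H1"
  and Inr_in_L [simp]: "Inr b \<in> L \<longleftrightarrow> b \<in> carrier H2"
  by (auto simp: letters_def)

lemma reduced_Nil [simp]: "reduced []"
  by (simp add: reduced_def)

lemma reduced_Cons:
  "reduced (x # w) \<longleftrightarrow> x \<in> L \<and> x \<noteq> Inl \<one>\<^bsub>H1\<^esub> \<and> x \<noteq> Inr \<one>\<^bsub>H2\<^esub> \<and> reduced w
     \<and> (w = [] \<or> isl x \<noteq> isl (hd w))"
  by (auto simp: reduced_def successively_Cons)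

lemma reduced_fp_cons: "x \<in> L \<Longrightarrow> reduced w \<Longrightarrow> reduced (fp_cons H1 H2 x w)"
  by (cases x; cases w rule: list.exhaust; cases "hd w") (auto simp: reduced_Cons)

lemma fp_eval_Nil [simp]: "ev [] = []"
  by (simp add: fp_eval_def)

lemma fp_eval_Cons: "ev (x # w) = fp_cons H1 H2 x (ev w)"
  by (simp add: fp_eval_def)

lemma reduced_fp_eval: "set w \<subseteq> L \<Longrightarrow> reduced (ev w)"
  by (induction w) (auto simp: fp_eval_Cons reduced_fp_cons)

lemma fp_cons_reduced: "reduced (x # w) \<Longrightarrow> fp_cons H1 H2 x w = x # w"
  by (cases x; cases w rule: list.exhaust; cases "hd w") (auto simp: reduced_Cons)

lemma fp_eval_reduced: "reduced w \<Longrightarrow> ev w = w"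
  by (induction w) (auto simp: fp_eval_Cons fp_cons_reduced reduced_Cons)

lemma fp_carrier_iff_reduced: "w \<in> fp_carrier H1 H2 \<longleftrightarrow> reduced w"
  using reduced_fp_eval fp_eval_reduced by (force simp: fp_carrier_def reduced_def)

text \<open>Van der Waerden's trick: each factor acts on the reduced words through
  \<open>fp_cons\<close>, and this is the law of that action. It replaces an associativity proof for
  a product of normal forms.\<close>

lemma fp_cons_Inl_Inl:
  assumes "a \<in> carrier H1" "b \<in> carrier H1" "reduced w"
  shows "fp_cons H1 H2 (Inl a) (fp_cons H1 H2 (Inl b) w) = fp_cons H1 H2 (Inl (a \<otimes>\<^bsub>H1\<^esub> b)) w"
proof -
  have *: "a \<otimes>\<^bsub>H1\<^esub> (b \<otimes>\<^bsub>H1\<^esub> c) = \<one>\<^bsub>H1\<^esub> \<longleftrightarrow> (a \<otimes>\<^bsub>H1\<^esub> b) \<otimes>\<^bsub>H1\<^esub> c = \<one>\<^bsub>H1\<^esub>" if "c \<in> carrier H1" for c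
    using assms that by (simp add: H1.m_assoc)
  have **: "c = a" if "a \<otimes>\<^bsub>H1\<^esub> b = \<one>\<^bsub>H1\<^esub>" "b \<otimes>\<^bsub>H1\<^esub> c = \<one>\<^bsub>H1\<^esub>" "c \<in> carrier H1" for c
    using assms that by (metis H1.inv_equality H1.inv_comm)
  have 1: "a \<otimes>\<^bsub>H1\<^esub> (b \<otimes>\<^bsub>H1\<^esub> c) = c" if "a \<otimes>\<^bsub>H1\<^esub> b = \<one>\<^bsub>H1\<^esub>" "c \<in> carrier H1" for c
    using assms that by (metis H1.m_assoc H1.l_one)
  have 2: "(a \<otimes>\<^bsub>H1\<^esub> b) \<otimes>\<^bsub>H1\<^esub> c = a" if "b \<otimes>\<^bsub>H1\<^esub> c = \<one>\<^bsub>H1\<^esub>" "c \<in> carrier H1" for c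
    using assms that by (metis H1.m_assoc H1.r_one)
  show ?thesis
  proof (cases w)
    case Nil
    then show ?thesis using assms by auto
  next
    case (Cons y v)
    then show ?thesis
    proof (cases y)
      case (Inr c)
      then show ?thesis using assms Cons by auto
    next
      case (Inl c)
      have c: "c \<in> carrier H1" "c \<noteq> \<one>\<^bsub>H1\<^esub>" and v: "v = [] \<or> \<not> isl (hd v)"
        using assms Cons Inl by (auto simp: reduced_Cons)
      show ?thesis
      proof (cases v)
        case Nil
        then show ?thesis using assms Cons Inl c by (auto simp: H1.m_assoc 1 ** dest: 2)
      next
        case (Cons z u)
        then obtain k where "z = Inr k" using v by (cases z) auto
        then show ?thesis using assms \<open>w = y # v\<close> Cons Inl c by (auto simp: H1.m_assoc 1 ** dest: 2)
      qed
    qed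
  qed
qed


text \<open>By symmetry: interchanging the factors with \<open>swp\<close> commutes with
  \<open>fp_cons\<close>, and injectivity of \<open>swp\<close> carries the equation back.\<close>

lemma fp_cons_Inr_Inr:
  assumes "a \<in> carrier H2" "b \<in> carrier H2" "reduced w"
  shows "fp_cons H1 H2 (Inr a) (fp_cons H1 H2 (Inr b) w) = fp_cons H1 H2 (Inr (a \<otimes>\<^bsub>H2\<^esub> b)) w"
proof -
  interpret sw: free_product H2 H1 by unfold_locales
  define swp :: "'a + 'b \<Rightarrow> 'b + 'a" where "swp = case_sum Inr Inl"
  have [simp]: "swp (Inl x) = Inr x" "swp (Inr y) = Inl y" for x y
    by (simp_all add: swp_def)
  have "inj swp"
    by (rule injI) (auto simp: swp_def split: sum.splits)
  have swap: "fp_cons H2 H1 (swp x) (map swp v) = map swp (fp_cons H1 H2 x v)" for x v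
    by (cases x; cases v rule: list.exhaust; cases "hd v") auto
  have isl_swp: "isl (swp x) \<longleftrightarrow> \<not> isl x" for x
    by (cases x) auto
  have "sw.reduced (map swp w)"
    using assms(3)
  proof (induction w)
    case (Cons x w)
    then show ?case
      by (cases x; cases w) (auto simp: reduced_Cons sw.reduced_Cons isl_swp)
  qed auto
  from sw.fp_cons_Inl_Inl[OF assms(1,2) this]
  have "map swp (fp_cons H1 H2 (Inr a) (fp_cons H1 H2 (Inr b) w))
      = map swp (fp_cons H1 H2 (Inr (a \<otimes>\<^bsub>H2\<^esub> b)) w)"
    using swap[of "Inr _"] by (simp del: fp_cons.simps)
  then show ?thesis
    using \<open>inj swp\<close> by (simp add: inj_map_eq_map)
qed

lemma reduced_foldr: "set w \<subseteq> L \<Longrightarrow> reduced z \<Longrightarrow> reduced (foldr (fp_cons H1 H2) w z)"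
  by (induction w) (auto simp: reduced_fp_cons)

lemma foldr_fp_cons:
  assumes "x \<in> L" "set w \<subseteq> L" "reduced z"
  shows "foldr (fp_cons H1 H2) (fp_cons H1 H2 x w) z = fp_cons H1 H2 x (foldr (fp_cons H1 H2) w z)"
proof (cases w)
  case Nil
  then show ?thesis using assms by (cases x) auto
next
  case (Cons y v)
  then have "reduced (foldr (fp_cons H1 H2) v z)"
    using assms by (auto intro: reduced_foldr)
  moreover have one: "fp_cons H1 H2 (Inl \<one>\<^bsub>H1\<^esub>) w = w" "fp_cons H1 H2 (Inr \<one>\<^bsub>H2\<^esub>) w = w" for w
    by simp_all
  moreover have "fp_cons H1 H2 (Inl a) (y # v) = (if a = \<one>\<^bsub>H1\<^esub> then y # v else case y of
      Inl b \<Rightarrow> if a \<otimes>\<^bsub>H1\<^esub> b = \<one>\<^bsub>H1\<^esub> then v else Inl (a \<otimes>\<^bsub>H1\<^esub> b) # v | Inr b \<Rightarrow> Inl a # y # v)"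
    "fp_cons H1 H2 (Inr c) (y # v) = (if c = \<one>\<^bsub>H2\<^esub> then y # v else case y of
      Inr b \<Rightarrow> if c \<otimes>\<^bsub>H2\<^esub> b = \<one>\<^bsub>H2\<^esub> then v else Inr (c \<otimes>\<^bsub>H2\<^esub> b) # v | Inl b \<Rightarrow> Inr c # y # v)" for a c
    by (auto split: sum.split)
  ultimately show ?thesis
    using assms Cons
    by (cases x; cases y) (auto simp: fp_cons_Inl_Inl fp_cons_Inr_Inr simp del: fp_cons.simps)
qed

lemma foldr_fp_eval:
  assumes "set u \<subseteq> L" "reduced z"
  shows "foldr (fp_cons H1 H2) (ev u) z = foldr (fp_cons H1 H2) u z"
  using assms
proof (induction u)
  case (Cons x u)
  then have "set (ev u) \<subseteq> L"
    using reduced_fp_eval[of u] by (auto simp: reduced_def)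
  then show ?case
    using Cons by (simp add: fp_eval_Cons foldr_fp_cons)
qed simp

lemma fp_eval_append: "ev (u @ v) = foldr (fp_cons H1 H2) u (ev v)"
  by (simp add: fp_eval_def)

text \<open>Stands in for multiplication in the free product, which is never built as a group.
  Nothing is asked of the letters of \<open>v'\<close>: its value equals that of \<open>v\<close>
  and is reduced for this reason.\<close>

lemma fp_eval_append_cong:
  assumes "ev u = ev u'" "ev v = ev v'" "set u \<subseteq> L" "set u' \<subseteq> L" "set v \<subseteq> L"
  shows "ev (u @ v) = ev (u' @ v')"
proof -
  have r: "reduced (ev v)" "reduced (ev v')"
    using reduced_fp_eval[of v] assms by auto
  have "ev (u @ v) = foldr (fp_cons H1 H2) (ev u) (ev v)"
    by (simp only: fp_eval_append foldr_fp_eval[OF assms(3) r(1)])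
  also have "\<dots> = foldr (fp_cons H1 H2) (ev u') (ev v')"
    by (simp only: assms(1,2))
  also have "\<dots> = ev (u' @ v')"
    by (simp only: fp_eval_append foldr_fp_eval[OF assms(4) r(2)])
  finally show ?thesis .
qed

lemma fp_eval_Inl_Inl_Cons:
  "a \<in> carrier H1 \<Longrightarrow> b \<in> carrier H1 \<Longrightarrow> set w \<subseteq> L \<Longrightarrow> ev (Inl a # Inl b # w) = ev (Inl (a \<otimes>\<^bsub>H1\<^esub> b) # w)"
  by (simp add: fp_eval_Cons fp_cons_Inl_Inl reduced_fp_eval del: fp_cons.simps)

lemma fp_eval_Inr_Inr_Cons:
  "a \<in> carrier H2 \<Longrightarrow> b \<in> carrier H2 \<Longrightarrow> set w \<subseteq> L \<Longrightarrow> ev (Inr a # Inr b # w) = ev (Inr (a \<otimes>\<^bsub>H2\<^esub> b) # w)"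
  by (simp add: fp_eval_Cons fp_cons_Inr_Inr reduced_fp_eval del: fp_cons.simps)

lemma fp_eval_Inl_one_Cons [simp]: "ev (Inl \<one>\<^bsub>H1\<^esub> # w) = ev w"
  and fp_eval_Inr_one_Cons [simp]: "ev (Inr \<one>\<^bsub>H2\<^esub> # w) = ev w"
  by (simp_all add: fp_eval_Cons)

definition inv_word :: "('a + 'b) list \<Rightarrow> ('a + 'b) list" where
  "inv_word w = rev (map (map_sum (m_inv H1) (m_inv H2)) w)"

lemma inv_word_in_L: "set w \<subseteq> L \<Longrightarrow> set (inv_word w) \<subseteq> L"
  by (auto simp: inv_word_def letters_def)

lemma inv_word_inv_word: "set w \<subseteq> L \<Longrightarrow> inv_word (inv_word w) = w"
  by (induction w) (auto simp: inv_word_def letters_def)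

lemma fp_eval_inv_word_right:
  assumes "set w \<subseteq> L"
  shows "ev (w @ inv_word w) = []"
  using assms
proof (induction w)
  case (Cons x w)
  let ?y = "map_sum (m_inv H1) (m_inv H2) x"
  have y: "?y \<in> L" and w: "set (inv_word w) \<subseteq> L"
    using Cons.prems inv_word_in_L[of w] by (auto simp: letters_def)
  have "ev (x # w @ inv_word (x # w)) = ev ([x] @ ((w @ inv_word w) @ [?y]))"
    by (simp add: inv_word_def)
  also have "\<dots> = ev ([x] @ [] @ [?y])"
    using Cons y w by (intro fp_eval_append_cong) auto
  also have "\<dots> = []"
    using Cons.prems by (cases x) (auto simp: fp_eval_Inl_Inl_Cons fp_eval_Inr_Inr_Cons)
  finally show ?case by simp
qed (simp add: inv_word_def)

lemma fp_eval_inv_word_left: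
  assumes "set w \<subseteq> L"
  shows "ev (inv_word w @ w) = []"
  using fp_eval_inv_word_right[OF inv_word_in_L[OF assms]] inv_word_inv_word[OF assms] by simp

end

section \<open>Graev distance of words\<close>

locale metric_free_product = free_product H1 H2
  for H1 :: "('a, 'm) monoid_scheme" and H2 :: "('b, 'n) monoid_scheme" +
  fixes d1 :: "'a \<Rightarrow> 'a \<Rightarrow> real" and d2 :: "'b \<Rightarrow> 'b \<Rightarrow> real"
  assumes inv_metric_d1: "inv_metric H1 d1" and inv_metric_d2: "inv_metric H2 d2"
begin

abbreviation ld where "ld \<equiv> letter_dist H1 H2 d1 d2"

lemma letter_dist_nonneg: "x \<in> L \<Longrightarrow> y \<in> L \<Longrightarrow> 0 \<le> ld x y"
  using inv_metric_d1 inv_metric_d2 by (cases x; cases y) (auto simp: inv_metric_def)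

lemma letter_dist_self: "x \<in> L \<Longrightarrow> ld x x = 0"
  using inv_metric_d1 inv_metric_d2 by (cases x) (auto simp: inv_metric_def)

lemma sum_list_letter_dist_nonneg: "set ps \<subseteq> L \<times> L \<Longrightarrow> 0 \<le> (\<Sum>(x, y)\<leftarrow>ps. ld x y)"
  by (rule sum_list_nonneg) (auto intro!: letter_dist_nonneg)

text \<open>A pair of words of equal length is a list of pairs of letters.\<close>

definition near :: "('a + 'b) list \<Rightarrow> ('a + 'b) list \<Rightarrow> real \<Rightarrow> bool" where
  "near u v r \<longleftrightarrow> (\<exists>ps. set ps \<subseteq> L \<times> L \<and> ev (map fst ps) = ev u \<and> ev (map snd ps) = ev v
     \<and> (\<Sum>(x, y)\<leftarrow>ps. ld x y) \<le> r)"

lemma set_map_fst_snd: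
  assumes "set ps \<subseteq> L \<times> L"
  shows "set (map fst ps) \<subseteq> L" "set (map snd ps) \<subseteq> L"
  using assms by auto

lemma near_cong: "near u v r \<Longrightarrow> ev u = ev u' \<Longrightarrow> ev v = ev v' \<Longrightarrow> r \<le> r' \<Longrightarrow> near u' v' r'"
  unfolding near_def by force

lemma near_fp_eval_eq:
  assumes "ev u = ev v" "set u \<subseteq> L" "0 \<le> r"
  shows "near u v r"
proof -
  have "(\<Sum>(x, y)\<leftarrow>map (\<lambda>x. (x, x)) u. ld x y) = 0"
    using assms(2) by (induction u) (auto simp: letter_dist_self)
  then show ?thesis
    using assms unfolding near_def by (intro exI[of _ "map (\<lambda>x. (x, x)) u"]) (auto simp: comp_def)
qed

lemma near_refl: "set u \<subseteq> L \<Longrightarrow> 0 \<le> r \<Longrightarrow> near u u r"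
  by (rule near_fp_eval_eq) auto

lemma near_letter: "x \<in> L \<Longrightarrow> y \<in> L \<Longrightarrow> ld x y \<le> r \<Longrightarrow> near [x] [y] r"
  unfolding near_def by (intro exI[of _ "[(x, y)]"]) auto

lemma near_append:
  assumes "near u v r" "near u' v' r'"
    and "set u \<subseteq> L" "set v \<subseteq> L" "set u' \<subseteq> L" "set v' \<subseteq> L" "r + r' \<le> r''"
  shows "near (u @ u') (v @ v') r''"
proof -
  obtain ps qs where ps: "set ps \<subseteq> L \<times> L" "ev (map fst ps) = ev u" "ev (map snd ps) = ev v"
      "(\<Sum>(x, y)\<leftarrow>ps. ld x y) \<le> r"
    and qs: "set qs \<subseteq> L \<times> L" "ev (map fst qs) = ev u'" "ev (map snd qs) = ev v'"
      "(\<Sum>(x, y)\<leftarrow>qs. ld x y) \<le> r'"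
    using assms unfolding near_def by blast
  have "ev (map fst (ps @ qs)) = ev (u @ u')" "ev (map snd (ps @ qs)) = ev (v @ v')"
    unfolding map_append
    using ps qs assms set_map_fst_snd[OF ps(1)] set_map_fst_snd[OF qs(1)] fp_eval_append_cong by metis+
  then show ?thesis
    using ps qs assms unfolding near_def by (intro exI[of _ "ps @ qs"]) auto
qed

text \<open>Two approximations may use different words for the value of \<open>v\<close> and cannot
  be composed letter by letter. They are concatenated instead, comparing \<open>u v^-1 v\<close>
  with \<open>v v^-1 w\<close>.\<close>

lemma near_trans:
  assumes "near u v r" "near v w s"
    and "set u \<subseteq> L" "set v \<subseteq> L" "set w \<subseteq> L" "r + s \<le> q"
  shows "near u w q"
proof -
  have v': "set (inv_word v) \<subseteq> L"
    using assms(4) by (rule inv_word_in_L)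
  have "near (inv_word v) (inv_word v) 0"
    using v' by (rule near_refl) simp
  then have "near (u @ inv_word v) (v @ inv_word v) r"
    using assms v' by (intro near_append[where r = r and r' = 0]) auto
  then have "near ((u @ inv_word v) @ v) ((v @ inv_word v) @ w) q"
    using assms v' by - (rule near_append[where r = r and r' = s], auto)
  moreover have "ev ((u @ inv_word v) @ v) = ev u"
    using assms v' fp_eval_append_cong[of u u "inv_word v @ v" "[]"] by (simp add: fp_eval_inv_word_left)
  moreover have "ev ((v @ inv_word v) @ w) = ev w"
    using assms v' fp_eval_append_cong[of "v @ inv_word v" "[]" w w] by (simp add: fp_eval_inv_word_right)
  ultimately show ?thesis
    by (rule near_cong) simp
qed

lemma graev_eq_Inf:
  "graev H1 H2 d1 d2 u v = Inf {\<Sum>(x, y)\<leftarrow>ps. ld x y |ps.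
     set ps \<subseteq> L \<times> L \<and> ev (map fst ps) = u \<and> ev (map snd ps) = v}" (is "_ = Inf ?S")
proof -
  let ?T = "{(\<Sum>i<length \<alpha>1. ld (\<alpha>1 ! i) (\<alpha>2 ! i)) | \<alpha>1 \<alpha>2.
        length \<alpha>1 = length \<alpha>2 \<and> set \<alpha>1 \<subseteq> L \<and> set \<alpha>2 \<subseteq> L \<and> ev \<alpha>1 = u \<and> ev \<alpha>2 = v}"
  have sum: "(\<Sum>i<length ps. ld (map fst ps ! i) (map snd ps ! i)) = (\<Sum>(x, y)\<leftarrow>ps. ld x y)" for ps
    by (simp add: sum_list_sum_nth case_prod_beta atLeast0LessThan)
  have "?T = ?S"
  proof (intro equalityI subsetI)
    fix c assume "c \<in> ?T"
    then obtain \<alpha>1 \<alpha>2 where c: "c = (\<Sum>i<length \<alpha>1. ld (\<alpha>1 ! i) (\<alpha>2 ! i))"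
      "length \<alpha>1 = length \<alpha>2" "set \<alpha>1 \<subseteq> L" "set \<alpha>2 \<subseteq> L" "ev \<alpha>1 = u" "ev \<alpha>2 = v"
      by auto
    then show "c \<in> ?S"
      using sum[of "zip \<alpha>1 \<alpha>2"] by (auto intro!: exI[of _ "zip \<alpha>1 \<alpha>2"] dest: set_zip_leftD set_zip_rightD)
  next
    fix c assume "c \<in> ?S"
    then obtain ps where c: "c = (\<Sum>(x, y)\<leftarrow>ps. ld x y)" "set ps \<subseteq> L \<times> L"
      "ev (map fst ps) = u" "ev (map snd ps) = v"
      by blast
    then show "c \<in> ?T"
      unfolding mem_Collect_eq using sum[of ps]
      by - (rule exI[of _ "map fst ps"], rule exI[of _ "map snd ps"], auto)
  qed
  then show ?thesis
    by (simp add: graev_def)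
qed

lemma graev_le:
  assumes "near u v r" "ev u = u" "ev v = v"
  shows "graev H1 H2 d1 d2 u v \<le> r"
proof -
  obtain ps where ps: "set ps \<subseteq> L \<times> L" "ev (map fst ps) = u" "ev (map snd ps) = v"
      "(\<Sum>(x, y)\<leftarrow>ps. ld x y) \<le> r"
    using assms unfolding near_def by auto
  then have "graev H1 H2 d1 d2 u v \<le> (\<Sum>(x, y)\<leftarrow>ps. ld x y)"
    unfolding graev_eq_Inf
    by (intro cInf_lower) (auto intro!: bdd_belowI[where m = 0] sum_list_letter_dist_nonneg)
  then show ?thesis
    using ps by simp
qed

lemma le_graev:
  assumes "set u \<subseteq> L" "set v \<subseteq> L" "ev u = u" "ev v = v"
    and "\<And>ps. set ps \<subseteq> L \<times> L \<Longrightarrow> ev (map fst ps) = u \<Longrightarrow> ev (map snd ps) = v \<Longrightarrow> c \<le> (\<Sum>(x, y)\<leftarrow>ps. ld x y)"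
  shows "c \<le> graev H1 H2 d1 d2 u v"
proof -
  let ?e = "Inl \<one>\<^bsub>H1\<^esub> :: 'a + 'b"
  \<comment> \<open>The infimum needs some approximation to exist: \<open>u\<close> is matched
    against identities, then identities against \<open>v\<close>.\<close>
  let ?ps = "map (\<lambda>x. (x, ?e)) u @ map (\<lambda>y. (?e, y)) v"
  have e: "ev (map (\<lambda>_. ?e) w) = []" for w :: "('a + 'b) list"
    by (induction w) (auto simp: fp_eval_Cons)
  have e_in_L: "(\<lambda>_. ?e) ` X \<subseteq> L" for X :: "('a + 'b) set"
    by auto
  have "ev (map fst ?ps) = u" "ev (map snd ?ps) = v"
    using assms fp_eval_append_cong[of u u "map (\<lambda>_. ?e) v" "[]"]
      fp_eval_append_cong[of "map (\<lambda>_. ?e) u" "[]" v v] e_in_L[of "set u"] e_in_L[of "set v"]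
    by (simp_all add: comp_def e)
  moreover have "set ?ps \<subseteq> L \<times> L"
    using assms by auto
  ultimately have "{\<Sum>(x, y)\<leftarrow>ps. ld x y |ps. set ps \<subseteq> L \<times> L \<and> ev (map fst ps) = u \<and> ev (map snd ps) = v} \<noteq> {}"
    by blast
  then show ?thesis
    unfolding graev_eq_Inf using assms(5) by (intro cInf_greatest) blast+
qed

end

section \<open>Contracting words over a group and a free letter\<close>

locale inv_metric_group = group G for G :: "('a, 'm) monoid_scheme" (structure) +
  fixes d :: "'a \<Rightarrow> 'a \<Rightarrow> real"
  assumes inv_metric: "inv_metric G d"
begin

lemma dist_nonneg: "x \<in> carrier G \<Longrightarrow> y \<in> carrier G \<Longrightarrow> 0 \<le> d x y"
  and dist_self: "x \<in> carrier G \<Longrightarrow> d x x = 0"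
  and dist_commute: "x \<in> carrier G \<Longrightarrow> y \<in> carrier G \<Longrightarrow> d x y = d y x"
  and dist_triangle: "x \<in> carrier G \<Longrightarrow> y \<in> carrier G \<Longrightarrow> z \<in> carrier G \<Longrightarrow> d x z \<le> d x y + d y z"
  and dist_left: "g \<in> carrier G \<Longrightarrow> x \<in> carrier G \<Longrightarrow> y \<in> carrier G \<Longrightarrow> d (g \<otimes> x) (g \<otimes> y) = d x y"
  and dist_right: "g \<in> carrier G \<Longrightarrow> x \<in> carrier G \<Longrightarrow> y \<in> carrier G \<Longrightarrow> d (x \<otimes> g) (y \<otimes> g) = d x y"
  using inv_metric unfolding inv_metric_def by blast+

text \<open>The letters \<open>Inr True\<close> and \<open>Inr False\<close> stand for \<open>t\<close> and its inverse. \<open>contracts w g r\<close> bounds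
  the Graev distance from \<open>w\<close> to \<open>g \<in> G\<close> by \<open>r\<close>. The cost of changing elements of \<open>G\<close> is paid in the
  rule for the empty word only, so that each letter can be split off a word by rule inversion.\<close>

inductive contracts :: "('a + bool) list \<Rightarrow> 'a \<Rightarrow> real \<Rightarrow> bool" where
  Nil: "g \<in> carrier G \<Longrightarrow> d g \<one> \<le> r \<Longrightarrow> contracts [] g r"
| letter: "a \<in> carrier G \<Longrightarrow> contracts w g r \<Longrightarrow> contracts (Inl a # w) (a \<otimes> g) r"
| delete: "contracts w g r \<Longrightarrow> contracts (Inr e # w) g (r + 1)"
| pair: "contracts u \<one> r \<Longrightarrow> contracts w g s \<Longrightarrow> contracts (Inr e # u @ Inr (\<not> e) # w) g (r + s)"

lemma contracts_carrier_nonneg: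
  assumes "contracts w g r"
  shows contracts_carrier: "g \<in> carrier G" and contracts_nonneg: "0 \<le> r"
proof -
  have "g \<in> carrier G \<and> 0 \<le> r"
    using assms
  proof induction
    case (Nil g r)
    then show ?case using dist_nonneg[of g \<one>] by simp
  qed auto
  then show "g \<in> carrier G" "0 \<le> r"
    by auto
qed

lemma contracts_mono: "contracts w g r \<Longrightarrow> r \<le> s \<Longrightarrow> contracts w g s"
proof (induction arbitrary: s rule: contracts.induct)
  case (delete w g r e)
  then show ?case using contracts.delete[of w g "s - 1" e] by simp
next
  case (pair u r w g q e)
  then show ?case using contracts.pair[of u r w g "s - r" e] by simp
qed (auto intro: contracts.intros)

text \<open>Left invariance carries the change of value past the letters of G to the empty suffix,
  where it is paid.\<close>

lemma contracts_change:
  "contracts w g r \<Longrightarrow> h \<in> carrier G \<Longrightarrow> contracts w h (r + d h g)"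
proof (induction arbitrary: h rule: contracts.induct)
  case (Nil g r)
  then show ?case
    using dist_triangle[of h g \<one>] by (auto intro: contracts.Nil)
next
  case (letter a w g r)
  note g = contracts_carrier[OF letter.hyps(2)]
  have "d h (a \<otimes> g) = d (inv a \<otimes> h) g"
    using letter g dist_left[of a "inv a \<otimes> h" g] by (simp add: inv_solve_left m_assoc[symmetric])
  then show ?case
    using letter contracts.letter[of a w "inv a \<otimes> h" "r + d h (a \<otimes> g)"] by (simp add: m_assoc[symmetric])
next
  case (delete w g r e)
  then show ?case using contracts.delete[of w h "r + d h g" e] by (simp add: algebra_simps)
next
  case (pair u r w g s e)
  then show ?case using contracts.pair[of u r w h "s + d h g" e] by (simp add: algebra_simps)
qed

lemma contracts_append:
  "contracts u g r \<Longrightarrow> contracts w h s \<Longrightarrow> contracts (u @ w) (g \<otimes> h) (r + s)"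
proof (induction rule: contracts.induct)
  case (Nil g r)
  note h = contracts_carrier[OF Nil.prems]
  have "d (g \<otimes> h) h \<le> r"
    using Nil h dist_right[of h g \<one>] by simp
  then show ?case
    using contracts_change[OF Nil.prems, of "g \<otimes> h"] Nil h by (auto elim: contracts_mono)
next
  case (letter a u g r)
  then show ?case
    using contracts.letter[of a "u @ w" "g \<otimes> h"] contracts_carrier[OF letter.hyps(2)]
      contracts_carrier[OF letter.prems] by (simp add: m_assoc)
next
  case (delete u g r e)
  then show ?case
    using contracts.delete[of "u @ w" "g \<otimes> h" "r + s" e] by (simp add: algebra_simps)
next
  case (pair u r v g q e)
  then show ?case
    using contracts.pair[of u r "v @ w" "g \<otimes> h" "q + s" e] by (simp add: algebra_simps)
qed

lemma contracts_append_one: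
  assumes "contracts u \<one> r" "contracts w h s" "r + s \<le> q"
  shows "contracts (u @ w) h q"
  using contracts_append[OF assms(1,2)] contracts_carrier[OF assms(2)] assms(3)
  by (auto elim: contracts_mono)

lemma contracts_Inr_cases:
  assumes "contracts (Inr e # w) g r"
  obtains "contracts w g (r - 1)"
  | u v s s' where "w = u @ Inr (\<not> e) # v" "contracts u \<one> s" "contracts v g s'" "s + s' = r"
  using assms by (cases rule: contracts.cases) auto

text \<open>The mirror image of \<open>contracts_Inr_cases\<close>; the rules expose only the first
  letter, so the last one takes an induction. It serves \<open>contracts_cancel\<close> where the
  interior of a pair ends with a cancelled letter.\<close>

lemma contracts_snoc_Inr_cases:
  assumes "contracts (p @ [Inr e]) g r"
  shows "contracts p g (r - 1) \<or>
    (\<exists>u v s s'. p = u @ Inr (\<not> e) # v \<and> contracts u g s \<and> contracts v \<one> s' \<and> s + s' \<le> r)"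
  using assms
proof (induction "p @ [Inr e :: 'a + bool]" g r arbitrary: p rule: contracts.induct)
  case (letter a w g r)
  then obtain p' where p: "p = Inl a # p'" "w = p' @ [Inr e]"
    by (cases p) auto
  from letter(3)[OF p(2)] show ?case
  proof (elim disjE exE conjE)
    fix u v s s'
    assume "p' = u @ Inr (\<not> e) # v" "contracts u g s" "contracts v \<one> s'" "s + s' \<le> r"
    then show ?thesis
      using p letter(1) contracts.letter[of a u g s] by (intro disjI2 exI[of _ "Inl a # u"] exI[of _ v]) auto
  qed (use p letter(1) contracts.letter in auto)
next
  case (delete w g r f)
  show ?case
  proof (cases p)
    case Nil
    then show ?thesis using delete by auto
  next
    case (Cons x p')
    then have p: "p = Inr f # p'" "w = p' @ [Inr e]"
      using delete by auto
    from delete(2)[OF p(2)] show ?thesis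
    proof (elim disjE exE conjE)
      assume "contracts p' g (r - 1)"
      then show ?thesis using p contracts.delete[of p' g "r - 1" f] by simp
    next
      fix u v s s'
      assume "p' = u @ Inr (\<not> e) # v" "contracts u g s" "contracts v \<one> s'" "s + s' \<le> r"
      then show ?thesis
        using p contracts.delete[of u g s f]
        by (intro disjI2 exI[of _ "Inr f # u"] exI[of _ v] exI[of _ "s + 1"] exI[of _ s']) auto
    qed
  qed
next
  case (pair u r w g q f)
  show ?case
  proof (cases w rule: rev_cases)
    case Nil
    then have "p = Inr f # u" "f = (\<not> e)"
      using pair by auto
    then show ?thesis
      using pair Nil
      by (intro disjI2 exI[of _ "[]"] exI[of _ u] exI[of _ q] exI[of _ r]) auto
  next
    case (snoc w' x)
    then have p: "p = Inr f # u @ Inr (\<not> f) # w'" "w = w' @ [Inr e]"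
      using pair(5) by (auto simp flip: append_Cons append_assoc)
    from pair(4)[OF p(2)] show ?thesis
    proof (elim disjE exE conjE)
      assume "contracts w' g (q - 1)"
      then show ?thesis using p pair(1) contracts.pair[of u r w' g "q - 1" f] by (simp add: add_diff_eq)
    next
      fix a b s s'
      assume "w' = a @ Inr (\<not> e) # b" "contracts a g s" "contracts b \<one> s'" "s + s' \<le> q"
      then show ?thesis
        using p pair(1) contracts.pair[of u r a g s f]
        by (intro disjI2 exI[of _ "Inr f # u @ Inr (\<not> f) # a"] exI[of _ b] exI[of _ "r + s"] exI[of _ s']) auto
    qed
  qed
qed auto

section \<open>Contractions survive free reduction\<close>

lemma append_Cons_eq_append_Cons_Cons:
  assumes "u @ x # v = p @ y # z # s"
  obtains (left) s' where "u = p @ y # z # s'" "s = s' @ x # v"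
  | (right) p' where "p = u @ x # p'" "v = p' @ y # z # s"
  | (snd) "u = p @ [y]" "x = z" "v = s"
  | (fst) "u = p" "x = y" "v = z # s"
  using assms by (auto simp: append_eq_append_conv2 append_eq_Cons_conv Cons_eq_append_conv)

text \<open>Rematching: if both cancelled letters had partners elsewhere, these are opposite letters
  and become partners of each other; if only one had a partner, that partner is deleted with the
  unit that the other's deletion cost. The cost never grows.\<close>

lemma contracts_cancel:
  "contracts (p @ Inr f # Inr (\<not> f) # s) g r \<Longrightarrow> contracts (p @ s) g r"
proof (induction "p @ Inr f # Inr (\<not> f) # s" g r arbitrary: p s rule: contracts.induct)
  case (letter a w g r)
  then obtain p' where "p = Inl a # p'" "w = p' @ Inr f # Inr (\<not> f) # s"
    by (cases p) auto
  then show ?case using letter contracts.letter by auto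
next
  case (delete w g r e)
  show ?case
  proof (cases p)
    case (Cons x p')
    then have "p = Inr e # p'" "w = p' @ Inr f # Inr (\<not> f) # s"
      using delete by auto
    then show ?thesis using delete contracts.delete by auto
  next
    \<comment> \<open>The first cancelled letter was deleted; its unit now deletes the partner of
      the second one, if there is one.\<close>
    case Nil
    then have w: "contracts (Inr (\<not> f) # s) g r"
      using delete by auto
    then show ?thesis
    proof (cases rule: contracts_Inr_cases)
      case 1
      then show ?thesis using Nil by (auto elim: contracts_mono)
    next
      case (2 u v q q')
      then show ?thesis
        using Nil contracts.delete[OF 2(3), of f] by (auto intro: contracts_append_one)
    qed
  qed
next
  case (pair u r w g q e)
  show ?case
  proof (cases p)
    case (Cons x p')
    then have p: "p = Inr e # p'" and "u @ Inr (\<not> e) # w = p' @ Inr f # Inr (\<not> f) # s"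
      using pair by auto
    from this(2) show ?thesis
    proof (cases rule: append_Cons_eq_append_Cons_Cons)
      case (left s')
      then show ?thesis using pair p contracts.pair[of "p' @ s'" r w g q e] by simp
    next
      case (right p'')
      then show ?thesis using pair p contracts.pair[of u r "p'' @ s" g q e] by simp
    next
      \<comment> \<open>The second cancelled letter closes the pair opened by \<open>e\<close>, and
        the first one is the last letter of its interior. The opening letter takes over the role of
        the first: deleted, or paired with its partner.\<close>
      case snd
      then have "contracts (p' @ [Inr e]) \<one> r"
        using pair by simp
      from contracts_snoc_Inr_cases[OF this] show ?thesis
      proof (elim disjE exE conjE)
        assume "contracts p' \<one> (r - 1)"
        then show ?thesis
          using p snd pair contracts.delete[of "p' @ s" g "r - 1 + q" e] by (simp add: contracts_append_one)
      next
        fix a b t t'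
        assume *: "p' = a @ Inr (\<not> e) # b" "contracts a \<one> t" "contracts b \<one> t'" "t + t' \<le> r"
        then have "contracts (b @ s) g (t' + q)"
          using snd pair by (auto intro: contracts_append_one)
        then show ?thesis
          using p * contracts.pair[of a t "b @ s" g "t' + q" e] by (auto elim: contracts_mono)
      qed
    next
      \<comment> \<open>The first cancelled letter closes the pair opened by \<open>e\<close>, so
        the opening letter takes over the role of the second.\<close>
      case fst
      then have "e = (\<not> f)"
        by auto
      then have "contracts (Inr e # s) g q"
        using fst pair by simp
      then show ?thesis
      proof (cases rule: contracts_Inr_cases)
        case 1
        then show ?thesis
          using p fst pair contracts.delete[of "u @ s" g "r + q - 1" e]
          by (simp add: contracts_append_one)
      next
        case (2 a b t t')
        then have "contracts (u @ a) \<one> (r + t)"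
          using pair by (auto intro: contracts_append_one)
        then show ?thesis
          using p fst 2 contracts.pair[of "u @ a" "r + t" b g t' e] by (auto simp: add.assoc)
      qed
    qed
  next
    \<comment> \<open>The first cancelled letter opens a pair. Either the second closes it at once,
      or it begins the interior and leaves its role to the closing letter.\<close>
    case Nil
    then have e: "e = f" and *: "u @ Inr (\<not> f) # w = Inr (\<not> f) # s"
      using pair by auto
    show ?thesis
    proof (cases u)
      case Nil
      then show ?thesis
        using \<open>p = []\<close> * pair contracts_nonneg[OF pair(1)] by (auto elim: contracts_mono)
    next
      case (Cons x u')
      then have s: "s = u' @ Inr (\<not> f) # w" and "contracts (Inr (\<not> f) # u') \<one> r"
        using pair * by auto
      from this(2) show ?thesis
      proof (cases rule: contracts_Inr_cases)
        case 1
        then show ?thesis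
          using \<open>p = []\<close> s contracts.delete[OF pair(3), of "\<not> f"] by (auto intro: contracts_append_one)
      next
        case (2 a b t t')
        then have "contracts (Inr f # b @ Inr (\<not> f) # w) g (t' + q)"
          using pair contracts.pair by auto
        then show ?thesis
          using \<open>p = []\<close> s 2 by (auto intro!: contracts_append_one[where r = t])
      qed
    qed
  qed
qed simp

lemma contracts_one:
  "contracts (p @ Inl \<one> # s) g r \<Longrightarrow> contracts (p @ s) g r"
proof (induction "p @ Inl \<one> # s :: ('a + bool) list" g r arbitrary: p s rule: contracts.induct)
  case (letter a w g r)
  then show ?case
    using contracts_carrier[OF letter(2)] by (cases p) (auto intro: contracts.letter)
next
  case (delete w g r e)
  then show ?case
    by (cases p) (auto intro: contracts.delete)
next
  case (pair u r w g q e)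
  then obtain p' where p: "p = Inr e # p'" "u @ Inr (\<not> e) # w = p' @ Inl \<one> # s"
    by (cases p) auto
  then consider s' where "u = p' @ Inl \<one> # s'" "s = s' @ Inr (\<not> e) # w"
    | p'' where "p' = u @ Inr (\<not> e) # p''" "w = p'' @ Inl \<one> # s"
    by (auto simp: append_eq_append_conv2 append_eq_Cons_conv Cons_eq_append_conv)
  then show ?case
  proof cases
    case 1
    then show ?thesis using pair p contracts.pair[of "p' @ s'" r w g q e] by simp
  next
    case 2
    then show ?thesis using pair p contracts.pair[of u r "p'' @ s" g q e] by simp
  qed
qed simp

lemma contracts_mult:
  assumes "a \<in> carrier G" "b \<in> carrier G"
  shows "contracts (p @ Inl a # Inl b # s) g r \<Longrightarrow> contracts (p @ Inl (a \<otimes> b) # s) g r"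
proof (induction "p @ Inl a # Inl b # s :: ('a + bool) list" g r arbitrary: p s rule: contracts.induct)
  case (letter c w g r)
  show ?case
  proof (cases p)
    case Nil
    then have "contracts (Inl b # s) g r"
      using letter by simp
    then obtain h where "g = b \<otimes> h" "contracts s h r"
      by (cases rule: contracts.cases) auto
    then show ?thesis
      using Nil letter assms contracts.letter[of "a \<otimes> b" s h r] contracts_carrier[of s h r]
      by (simp add: m_assoc)
  next
    case (Cons x p')
    then show ?thesis using letter by (auto intro: contracts.letter)
  qed
next
  case (delete w g r e)
  then show ?case
    by (cases p) (auto intro: contracts.delete)
next
  case (pair u r w g q e)
  then obtain p' where p: "p = Inr e # p'" "u @ Inr (\<not> e) # w = p' @ Inl a # Inl b # s"
    by (cases p) auto
  from p(2) show ?case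
  proof (cases rule: append_Cons_eq_append_Cons_Cons)
    case (left s')
    then show ?thesis using pair p contracts.pair[of "p' @ Inl (a \<otimes> b) # s'" r w g q e] by simp
  next
    case (right p'')
    then show ?thesis using pair p contracts.pair[of u r "p'' @ Inl (a \<otimes> b) # s" g q e] by simp
  qed auto
qed simp

end

lemma inv_metric_integer_group: "inv_metric integer_group int_dist"
  by (auto simp: inv_metric_def int_dist_def integer_group_def)

context inv_metric_group
begin

sublocale FZ: metric_free_product G integer_group d int_dist
  by (intro metric_free_product.intro free_product.intro metric_free_product_axioms.intro
      is_group group_integer_group inv_metric inv_metric_integer_group)

section \<open>Free reduction of words over G and t\<close>

inductive reduces :: "('a + bool) list \<Rightarrow> ('a + bool) list \<Rightarrow> bool" where
  base: "reduces w w"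
| one: "reduces (p @ s) w \<Longrightarrow> reduces (p @ Inl \<one> # s) w"
| mult: "a \<in> carrier G \<Longrightarrow> b \<in> carrier G \<Longrightarrow> reduces (p @ Inl (a \<otimes> b) # s) w
    \<Longrightarrow> reduces (p @ Inl a # Inl b # s) w"
| cancel: "reduces (p @ s) w \<Longrightarrow> reduces (p @ Inr e # Inr (\<not> e) # s) w"

lemma contracts_reduces: "reduces u w \<Longrightarrow> contracts u g r \<Longrightarrow> contracts w g r"
  by (induction rule: reduces.induct) (auto dest: contracts_one contracts_mult contracts_cancel)

lemma reduces_trans: "reduces u v \<Longrightarrow> reduces v w \<Longrightarrow> reduces u w"
  by (induction rule: reduces.induct) (auto intro: reduces.intros)

lemma reduces_context: "reduces u w \<Longrightarrow> reduces (x @ u @ y) (x @ w @ y)"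
proof (induction rule: reduces.induct)
  case (one p s w)
  then show ?case using reduces.one[of "x @ p" "s @ y"] by simp
next
  case (mult a b p s w)
  then show ?case using reduces.mult[of a b "x @ p" "s @ y"] by simp
next
  case (cancel p s w e)
  then show ?case using reduces.cancel[of "x @ p" "s @ y" _ e] by simp
qed (auto intro: reduces.intros)

lemma reduces_append: "reduces u u' \<Longrightarrow> reduces w w' \<Longrightarrow> reduces (u @ w) (u' @ w')"
  using reduces_context[of u u' "[]" w] reduces_context[of w w' u' "[]"] by (auto intro: reduces_trans)

definition inv_path :: "('a + bool) list \<Rightarrow> ('a + bool) list" where
  "inv_path w = rev (map (map_sum (m_inv G) Not) w)"

lemma inv_path_append [simp]: "inv_path (u @ w) = inv_path w @ inv_path u"
  and inv_path_Nil [simp]: "inv_path [] = []"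
  and inv_path_Cons: "inv_path (x # w) = inv_path w @ [map_sum (m_inv G) Not x]"
  by (simp_all add: inv_path_def)

lemma reduces_inv_path: "reduces u w \<Longrightarrow> reduces (inv_path u) (inv_path w)"
proof (induction rule: reduces.induct)
  case (one p s w)
  then show ?case using reduces.one by (simp add: inv_path_Cons)
next
  case (mult a b p s w)
  then show ?case
    using reduces.mult[of "inv b" "inv a" "inv_path s" "inv_path p"] by (simp add: inv_path_Cons inv_mult_group)
next
  case (cancel p s w e)
  then show ?case using reduces.cancel[of "inv_path s" "inv_path p" _ e] by (simp add: inv_path_Cons)
qed (auto intro: reduces.intros)

definition t_power :: "int \<Rightarrow> ('a + bool) list" where
  "t_power n = replicate (nat \<bar>n\<bar>) (Inr (0 < n))"

definition expand :: "('a + int) list \<Rightarrow> ('a + bool) list" where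
  "expand w = concat (map (case_sum (\<lambda>a. [Inl a]) t_power) w)"

lemma expand_simps [simp]:
  "expand [] = []" "expand (Inl a # w) = Inl a # expand w" "expand (Inr n # w) = t_power n @ expand w"
  "expand (u @ w) = expand u @ expand w"
  by (simp_all add: expand_def)

text \<open>Subtraction of natural numbers is truncated, so at most one of the two resulting blocks
  is nonempty.\<close>

lemma reduces_replicate:
  "reduces (replicate i (Inr e) @ replicate j (Inr (\<not> e)))
    (replicate (i - j) (Inr e) @ replicate (j - i) (Inr (\<not> e)))"
proof (induction i j rule: diff_induct)
  case (3 i j)
  then show ?case
    using reduces.cancel[of "replicate i (Inr e)" "replicate j (Inr (\<not> e))" _ e]
    by (simp flip: replicate_append_same)
qed (auto intro: reduces.base)

lemma reduces_t_power: "reduces (t_power m @ t_power n) (t_power (m + n))"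
proof -
  consider "0 < m \<longleftrightarrow> 0 < n" | "0 < m" "n \<le> 0" | "m \<le> 0" "0 < n"
    by linarith
  then show ?thesis
  proof cases
    case 1
    then have "nat \<bar>m + n\<bar> = nat \<bar>m\<bar> + nat \<bar>n\<bar>" and "(0 < m + n) = (0 < m)"
      by auto
    then show ?thesis
      using 1 by (simp add: t_power_def replicate_add reduces.base)
  next
    case 2
    then have "nat m - nat (- n) = nat (m + n)" "nat (- n) - nat m = nat (- (m + n))"
      by linarith+
    then show ?thesis
      using 2 reduces_replicate[of "nat m" True "nat (- n)"]
      by (cases "0 < m + n") (simp_all add: t_power_def)
  next
    case 3
    then have "nat n - nat (- m) = nat (m + n)" "nat (- m) - nat n = nat (- (m + n))"
      by linarith+
    then show ?thesis
      using 3 reduces_replicate[of "nat (- m)" False "nat n"]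
      by (cases "0 < m + n") (simp_all add: t_power_def)
  qed
qed

lemma reduces_expand_Cons:
  assumes "set (x # w) \<subseteq> FZ.L"
  shows "reduces (expand (x # w)) (expand (fp_cons G integer_group x w))"
proof -
  have one: "reduces (Inl \<one> # u) u" for u
    using reduces.one[of "[]" u u] by (simp add: reduces.base)
  have mult: "reduces (Inl a # Inl b # u) (Inl (a \<otimes> b) # u)" if "a \<in> carrier G" "b \<in> carrier G" for a b u
    using reduces.mult[of a b "[]" u] that by (simp add: reduces.base)
  have t: "reduces (t_power m @ t_power n @ u) (t_power (m + n) @ u)" for m n u
    using reduces_append[OF reduces_t_power reduces.base] by simp
  show ?thesis
  proof (cases x)
    case (Inl a)
    show ?thesis
    proof (cases "\<exists>b v. w = Inl b # v")
      case True
      then obtain b v where "w = Inl b # v" by blast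
      then show ?thesis
        using Inl assms mult[of a b "expand v"] one[of "expand v"] one[of "expand w"]
        by (auto intro: reduces_trans)
    next
      case False
      then show ?thesis
        using Inl assms one[of "expand w"] by (auto split: list.split sum.split intro: reduces.base)
    qed
  next
    case (Inr m)
    show ?thesis
    proof (cases "\<exists>n v. w = Inr n # v")
      case True
      then obtain n v where "w = Inr n # v" by blast
      then show ?thesis
        using Inr t[of m n "expand v"]
        by (auto simp: t_power_def integer_group_def intro: reduces.base)
    next
      case False
      then show ?thesis
        using Inr by (auto simp: t_power_def integer_group_def split: list.split sum.split intro: reduces.base)
    qed
  qed
qed

lemma reduces_expand_fp_eval: "set w \<subseteq> FZ.L \<Longrightarrow> reduces (expand w) (expand (FZ.ev w))"
proof (induction w)
  case (Cons x w)
  have "set (x # FZ.ev w) \<subseteq> FZ.L"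
    using Cons.prems FZ.reduced_fp_eval[of w] by (auto simp: FZ.reduced_def)
  moreover have "reduces (expand [x] @ expand w) (expand [x] @ expand (FZ.ev w))"
    using Cons by (intro reduces_append reduces.base) auto
  ultimately show ?case
    using reduces_expand_Cons[of x "FZ.ev w"]
    by (auto simp: FZ.fp_eval_Cons simp flip: expand_simps(4) simp del: fp_cons.simps intro: reduces_trans)
qed (simp add: reduces.base)

section \<open>From approximating words to contractions\<close>

lemma contracts_replicate: "contracts (replicate i (Inr e)) \<one> (real i)"
proof (induction i)
  case (Suc i)
  then show ?case
    using contracts.delete[OF Suc, of e] by (simp add: add.commute)
qed (simp add: dist_self contracts.Nil)

text \<open>As many letters as possible are matched in nested pairs around \<open>w\<close>; only
  the surplus on one side is deleted.\<close>

lemma contracts_conj_replicate: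
  "contracts w \<one> r
    \<Longrightarrow> contracts (replicate i (Inr (\<not> e)) @ w @ replicate j (Inr e)) \<one> (r + \<bar>real i - real j\<bar>)"
proof (induction i j rule: diff_induct)
  case (1 i)
  then show ?case
    using contracts_append_one[OF contracts_replicate[of i "\<not> e"] 1 order_refl] by (simp add: add.commute)
next
  case (2 j)
  then show ?case
    using contracts_append_one[OF 2 contracts_replicate[of "Suc j" e] order_refl] by (simp add: add.commute)
next
  case (3 i j)
  have snoc: "replicate (Suc j) (Inr e) = replicate j (Inr e) @ [Inr e]"
    by (simp flip: replicate_append_same)
  from contracts.pair[OF 3(1)[OF 3(2)] contracts.Nil[of \<one> 0], of "\<not> e"]
  show ?case
    unfolding snoc by (simp add: dist_self)
qed

lemma contracts_t_power: "contracts (t_power n) \<one> (int_dist 0 n)"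
  using contracts_replicate[of "nat \<bar>n\<bar>" "0 < n"] by (simp add: t_power_def int_dist_def)

lemma inv_path_t_power: "inv_path (t_power n) = t_power (- n)"
  by (cases n "0 :: int" rule: linorder_cases) (simp_all add: inv_path_def t_power_def)

text \<open>Letters of different kinds are removed separately, each at the cost of its distance from
  the identity. Two letters of G are merged around \<open>w\<close>, and two powers of
  \<open>t\<close> with the same sign are matched from the inside out.\<close>

lemma contracts_conj_letters:
  assumes "contracts w \<one> r" "x \<in> FZ.L" "y \<in> FZ.L"
  shows "contracts (inv_path (expand [y]) @ w @ expand [x]) \<one> (r + FZ.ld x y)"
proof -
  have d_inv: "d (inv a) \<one> = d a \<one>" if "a \<in> carrier G" for a
    using dist_right[of "inv a" a \<one>] dist_commute[of \<one> "inv a"] that by simp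
  have single: "contracts [Inl a] \<one> (d a \<one>)" if "a \<in> carrier G" for a
    using contracts.letter[OF that contracts.Nil[of "inv a" "d a \<one>"]] that by (simp add: d_inv)
  consider a b where "x = Inl a" "y = Inl b" | a n where "x = Inl a" "y = Inr n"
    | n b where "x = Inr n" "y = Inl b" | m n where "x = Inr m" "y = Inr n"
    by (cases x; cases y) auto
  then show ?thesis
  proof cases
    case 1
    then have ab: "a \<in> carrier G" "b \<in> carrier G"
      using assms by auto
    have "contracts [Inl a] a 0"
      using contracts.letter[OF ab(1) contracts.Nil[of \<one> 0]] ab by (simp add: dist_self)
    from contracts.letter[OF inv_closed[OF ab(2)] contracts_append[OF assms(1) this]]
    have "contracts (Inl (inv b) # w @ [Inl a]) (inv b \<otimes> a) r"
      using ab by simp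
    from contracts_change[OF this, of \<one>] show ?thesis
      using 1 ab dist_left[of "inv b" b a] by (simp add: inv_path_def dist_commute)
  next
    case 2
    then have a: "a \<in> carrier G"
      using assms by auto
    have "int_dist 0 (- n) = int_dist 0 n"
      by (simp add: int_dist_def)
    then show ?thesis
      using 2 a contracts_append_one[OF contracts_t_power[of "- n"]
          contracts_append_one[OF assms(1) single[OF a] order_refl], of "r + FZ.ld x y"]
      by (simp add: inv_path_t_power)
  next
    case 3
    then have b: "b \<in> carrier G"
      using assms by auto
    then show ?thesis
      using 3 contracts_append_one[OF single[of "inv b"]
          contracts_append_one[OF assms(1) contracts_t_power[of n] order_refl], of "r + FZ.ld x y"]
      by (simp add: inv_path_def d_inv)
  next
    case 4
    show ?thesis
    proof (cases "(0 < m) = (0 < n)")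
      case True
      then have "\<bar>real (nat \<bar>n\<bar>) - real (nat \<bar>m\<bar>)\<bar> = int_dist m n"
        by (auto simp: int_dist_def)
      then show ?thesis
        using contracts_conj_replicate[OF assms(1), of "nat \<bar>n\<bar>" "0 < m" "nat \<bar>m\<bar>"] 4 True
        by (simp add: inv_path_def t_power_def)
    next
      \<comment> \<open>Without a common sign the distance is \<open>|m| + |n|\<close>, so every
        letter may be deleted.\<close>
      case False
      then have "int_dist 0 (- n) + int_dist 0 m = int_dist m n"
        by (auto simp: int_dist_def)
      then show ?thesis
        using 4 contracts_append_one[OF contracts_t_power[of "- n"]
          contracts_append_one[OF assms(1) contracts_t_power[of m] order_refl], of "r + FZ.ld x y"]
        by (simp add: inv_path_t_power)
    qed
  qed
qed

text \<open>In \<open>v^-1 u\<close> the pairs of letters are nested with the last pair outermost;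
  hence the induction from the right.\<close>

lemma contracts_expand_pairs:
  "set ps \<subseteq> FZ.L \<times> FZ.L \<Longrightarrow>
    contracts (inv_path (expand (map snd ps)) @ expand (map fst ps)) \<one> (\<Sum>(x, y)\<leftarrow>ps. FZ.ld x y)"
proof (induction ps rule: rev_induct)
  case Nil
  then show ?case by (simp add: contracts.Nil dist_self)
next
  case (snoc xy ps)
  obtain x y where "xy = (x, y)" by (cases xy)
  then show ?case
    using snoc contracts_conj_letters[of "inv_path (expand (map snd ps)) @ expand (map fst ps)" _ x y]
    by simp
qed

text \<open>The approximating words are arbitrary, whereas the later labelling by states needs the
  normal forms; free reduction leads from the former to the latter at no extra cost.\<close>

lemma contracts_of_near:
  assumes "FZ.near u v r"
  shows "contracts (inv_path (expand (FZ.ev v)) @ expand (FZ.ev u)) \<one> r"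
proof -
  obtain ps where ps: "set ps \<subseteq> FZ.L \<times> FZ.L" "FZ.ev (map fst ps) = FZ.ev u" "FZ.ev (map snd ps) = FZ.ev v"
    "(\<Sum>(x, y)\<leftarrow>ps. FZ.ld x y) \<le> r"
    using assms unfolding FZ.near_def by blast
  have "reduces (inv_path (expand (map snd ps)) @ expand (map fst ps)) (inv_path (expand (FZ.ev v)) @ expand (FZ.ev u))"
    using FZ.set_map_fst_snd[OF ps(1)] ps(2,3) reduces_expand_fp_eval[of "map fst ps"] reduces_expand_fp_eval[of "map snd ps"]
    by (intro reduces_append reduces_inv_path) auto
  from contracts_reduces[OF this contracts_expand_pairs[OF ps(1)]] show ?thesis
    using ps(4) by (rule contracts_mono)
qed

end

section \<open>Paths with endpoints in the subgroup\<close>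

locale inv_metric_subgroup = inv_metric_group G d
  for G :: "('a, 'm) monoid_scheme" (structure) and d :: "'a \<Rightarrow> 'a \<Rightarrow> real" +
  fixes A :: "'a set"
  assumes subgroup: "subgroup A G"
begin

abbreviation GA where "GA \<equiv> G\<lparr>carrier := A\<rparr>"

lemma in_carrier [simp]: "a \<in> A \<Longrightarrow> a \<in> carrier G"
  and mult_in_A [simp]: "a \<in> A \<Longrightarrow> b \<in> A \<Longrightarrow> a \<otimes> b \<in> A"
  and inv_in_A [simp]: "a \<in> A \<Longrightarrow> inv a \<in> A"
  and one_in_A [simp]: "\<one> \<in> A"
  using subgroup by (simp_all add: subgroup.mem_carrier subgroup.m_closed subgroup.m_inv_closed subgroup.one_closed)

sublocale K: metric_free_product G GA d d
proof (intro metric_free_product.intro free_product.intro metric_free_product_axioms.intro)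
  show "group GA"
    using subgroup by (rule subgroup_imp_group)
  show "inv_metric GA d"
    using inv_metric unfolding inv_metric_def by simp
qed (simp_all add: inv_metric is_group)

lemma fp_eval_Inr_one [simp]: "K.ev (Inr \<one> # w) = K.ev w"
  using K.fp_eval_Inr_one_Cons by simp

text \<open>States of a path: \<open>True\<close> for \<open>G\<close>, \<open>False\<close> for the conjugate of \<open>A\<close>; the letter \<open>t\<close> leads from
  \<open>G\<close> to the conjugate, its inverse leads back.\<close>

fun path :: "bool \<Rightarrow> ('a + bool) list \<Rightarrow> bool \<Rightarrow> bool" where
  "path s [] s' \<longleftrightarrow> s = s'"
| "path s (Inl a # w) s' \<longleftrightarrow> a \<in> (if s then carrier G else A) \<and> path s w s'"
| "path s (Inr e # w) s' \<longleftrightarrow> e = s \<and> path (\<not> s) w s'"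

fun label :: "bool \<Rightarrow> ('a + bool) list \<Rightarrow> ('a + 'a) list" where
  "label s [] = []"
| "label s (Inl a # w) = (if s then Inl a else Inr a) # label s w"
| "label s (Inr e # w) = label (\<not> s) w"

lemma path_append: "path s (u @ w) s' \<longleftrightarrow> (\<exists>m. path s u m \<and> path m w s')"
  by (induction s u s' rule: path.induct) auto

lemma label_append: "path s u m \<Longrightarrow> label s (u @ w) = label s u @ label m w"
  by (induction s u m rule: path.induct) auto

lemma label_in_L: "path s u m \<Longrightarrow> set (label s u) \<subseteq> K.L"
  by (induction s u m rule: path.induct) auto

lemma path_inv_path:
  "path s u s' \<Longrightarrow> path s' (inv_path u) s \<and> label s' (inv_path u) = K.inv_word (label s u)"
proof (induction s u s' rule: path.induct)
  case (2 s a w s')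
  then show ?case
    using m_inv_consistent[OF subgroup, of a]
    by (auto simp: inv_path_Cons path_append label_append K.inv_word_def split: if_splits)
next
  case (3 s e w s')
  then show ?case
    by (auto simp: inv_path_Cons path_append label_append K.inv_word_def)
qed (auto simp: K.inv_word_def)

section \<open>The embedding and its paths\<close>

definition conj_image :: "('a + 'a) list \<Rightarrow> ('a + int) list" where
  "conj_image w = concat (map (\<lambda>x. case x of Inl g \<Rightarrow> [Inl g] | Inr a \<Rightarrow> [Inr 1, Inl a, Inr (-1)]) w)"

lemma conj_image_simps [simp]:
  "conj_image [] = []" "conj_image (Inl a # w) = Inl a # conj_image w"
  "conj_image (Inr a # w) = Inr 1 # Inl a # Inr (-1) # conj_image w"
  by (simp_all add: conj_image_def)

lemma conj_embed_eq: "conj_embed G w = FZ.ev (conj_image w)"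
  by (simp add: conj_embed_def conj_image_def)

text \<open>In a reduced word, two conjugated letters are separated by a nontrivial letter of G, so
  no \<open>t^-1\<close> meets a \<open>t\<close>. This is why the embedded words are normal forms
  as they stand.\<close>

lemma conj_image_reduced: "K.reduced w \<Longrightarrow> FZ.reduced (conj_image w)"
proof (induction w)
  case (Cons x w)
  then show ?case
    by (cases x; cases w rule: list.exhaust; cases "hd w") (auto simp: FZ.reduced_Cons K.reduced_Cons)
qed simp

lemma path_conj_image:
  "set w \<subseteq> K.L \<Longrightarrow> path True (expand (conj_image w)) True \<and> label True (expand (conj_image w)) = w"
proof (induction w)
  case (Cons x w)
  then show ?case by (cases x) (auto simp: t_power_def)
qed simp

text \<open>What a contraction in \<open>G * \<langle>t\<rangle>\<close> gives for the labels: the costs \<open>1\<close> and \<open>2\<close> taken off \<open>r\<close> are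
  those of the deleted letters \<open>t\<^sup>\<plusminus>\<^sup>1\<close> at which the path has changed state without a partner. The
  saved cost \<open>2\<close> later pays for \<open>near_Inr_Inl\<close>, the move of an element of \<open>A\<close> from one factor to the
  other.\<close>

fun contracted :: "bool \<Rightarrow> bool \<Rightarrow> ('a + 'a) list \<Rightarrow> 'a \<Rightarrow> real \<Rightarrow> bool" where
  "contracted True True w g r \<longleftrightarrow> K.near w [Inl g] r"
| "contracted True False w g r \<longleftrightarrow> (\<exists>a\<in>A. K.near w [Inl (g \<otimes> inv a), Inr a] (r - 1))"
| "contracted False True w g r \<longleftrightarrow> (\<exists>a\<in>A. K.near w [Inr a, Inl (inv a \<otimes> g)] (r - 1))"
| "contracted False False w g r \<longleftrightarrow>
     (\<exists>a\<in>A. K.near w [Inr a] (r - d a g)) \<or>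
     (\<exists>a\<in>A. \<exists>b\<in>A. K.near w [Inr a, Inl (inv a \<otimes> g \<otimes> inv b), Inr b] (r - 2))"

section \<open>Tracking a contraction on the labels\<close>

lemma near_Cons:
  "K.near v w r \<Longrightarrow> x \<in> K.L \<Longrightarrow> set v \<subseteq> K.L \<Longrightarrow> set w \<subseteq> K.L \<Longrightarrow> K.near (x # v) (x # w) r"
  using K.near_append[OF K.near_refl[of "[x]" 0], of v w r r] by simp

lemma near_Cons_cong:
  assumes "K.near v w r" "K.ev (x # w) = K.ev w'" "x \<in> K.L" "set v \<subseteq> K.L" "set w \<subseteq> K.L"
  shows "K.near (x # v) w' r"
  using near_Cons[OF assms(1,3,4,5)] assms(2) K.near_cong by blast

text \<open>The new letter is absorbed by the leading letter of the target. In the conjugate factor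
  this leaves \<open>inv b \<otimes> g\<close> and, by left invariance, the reserve
  \<open>d b g\<close> unchanged.\<close>

lemma contracted_letter:
  assumes "contracted s s' v g r" "a \<in> (if s then carrier G else A)" "set v \<subseteq> K.L" "g \<in> carrier G"
  shows "contracted s s' ((if s then Inl a else Inr a) # v) (a \<otimes> g) r"
proof (cases s; cases s')
  assume s: "s" "s'"
  then show ?thesis
    using assms by (auto intro!: near_Cons_cong[where w = "[Inl g]"] K.fp_eval_Inl_Inl_Cons)
next
  assume s: "s" "\<not> s'"
  then obtain b where b: "b \<in> A" "K.near v [Inl (g \<otimes> inv b), Inr b] (r - 1)"
    using assms by auto
  have "K.ev [Inl a, Inl (g \<otimes> inv b), Inr b] = K.ev [Inl (a \<otimes> g \<otimes> inv b), Inr b]"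
    using s b assms by (simp add: K.fp_eval_Inl_Inl_Cons m_assoc)
  then have "K.near (Inl a # v) [Inl (a \<otimes> g \<otimes> inv b), Inr b] (r - 1)"
    using s assms b by - (rule near_Cons_cong[OF b(2)], auto)
  then show ?thesis
    using s b by auto
next
  assume s: "\<not> s" "s'"
  then obtain b where b: "b \<in> A" "K.near v [Inr b, Inl (inv b \<otimes> g)] (r - 1)"
    using assms by auto
  have "inv (a \<otimes> b) \<otimes> (a \<otimes> g) = inv b \<otimes> g"
    using s b assms by (simp add: inv_mult_group m_assoc inv_solve_left')
  then have "K.near (Inr a # v) [Inr (a \<otimes> b), Inl (inv (a \<otimes> b) \<otimes> (a \<otimes> g))] (r - 1)"
    using s assms b by - (rule near_Cons_cong[OF b(2)], auto simp: K.fp_eval_Inr_Inr_Cons)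
  then show ?thesis
    using s b assms by (auto intro!: bexI[of _ "a \<otimes> b"])
next
  assume s: "\<not> s" "\<not> s'"
  then have "a \<in> A"
    using assms by simp
  from s assms consider b where "b \<in> A" "K.near v [Inr b] (r - d b g)"
    | b c where "b \<in> A" "c \<in> A" "K.near v [Inr b, Inl (inv b \<otimes> g \<otimes> inv c), Inr c] (r - 2)"
    by auto
  then show ?thesis
  proof cases
    case 1
    then have "K.near (Inr a # v) [Inr (a \<otimes> b)] (r - d (a \<otimes> b) (a \<otimes> g))"
      using s assms by (auto intro!: near_Cons_cong[OF 1(2)] simp: K.fp_eval_Inr_Inr_Cons dist_left)
    then show ?thesis
      using s 1 \<open>a \<in> A\<close> by (auto intro!: bexI[of _ "a \<otimes> b"])
  next
    case 2
    then have *: "inv (a \<otimes> b) \<otimes> (a \<otimes> g) = inv b \<otimes> g"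
      using \<open>a \<in> A\<close> assms by (simp add: inv_mult_group m_assoc inv_solve_left')
    have "K.near (Inr a # v) [Inr (a \<otimes> b), Inl (inv (a \<otimes> b) \<otimes> (a \<otimes> g) \<otimes> inv c), Inr c] (r - 2)"
      unfolding * using 2 \<open>a \<in> A\<close> assms
      by (auto intro!: near_Cons_cong[OF 2(3)] simp: K.fp_eval_Inr_Inr_Cons)
    then have "\<exists>b\<in>A. \<exists>c\<in>A. K.near (Inr a # v) [Inr b, Inl (inv b \<otimes> (a \<otimes> g) \<otimes> inv c), Inr c] (r - 2)"
      using 2 \<open>a \<in> A\<close> mult_in_A by blast
    then show ?thesis
      using s by simp
  qed
qed

text \<open>The letter distance across the factors passes through the identity and is 2 d(a,1)
  here.\<close>

lemma near_Inr_Inl: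
  assumes "\<And>a. a \<in> A \<Longrightarrow> d a \<one> \<le> 1"
    and "K.near v (p @ Inr a # q) r" "a \<in> A" "set v \<subseteq> K.L" "set p \<subseteq> K.L" "set q \<subseteq> K.L"
  shows "K.near v (p @ Inl a # q) (r + 2)"
proof -
  have "K.near [Inr a] [Inl a] 2"
    using assms(1)[of a] assms(3) dist_commute[of a \<one>] by (auto intro!: K.near_letter)
  then have "K.near ([Inr a] @ q) ([Inl a] @ q) 2"
    using assms by (intro K.near_append[where r = 2 and r' = 0] K.near_refl) auto
  then have "K.near (p @ [Inr a] @ q) (p @ [Inl a] @ q) 2"
    using assms by - (rule K.near_append[where r = 0 and r' = 2], auto intro: K.near_refl)
  moreover have "K.near v (p @ [Inr a] @ q) r"
    using assms by simp
  ultimately show ?thesis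
    using assms K.near_trans[of v "p @ [Inr a] @ q" r "p @ [Inl a] @ q" 2 "r + 2"] by auto
qed

text \<open>A start in the conjugate factor is obtained by prefixing a trivial letter, and the new
  unit goes into the reserve. A start in G encloses the leading conjugated letter, which is moved
  into G for 2: the new unit and the one reserved before.\<close>

lemma contracted_delete:
  assumes small: "\<And>a. a \<in> A \<Longrightarrow> d a \<one> \<le> 1"
    and "contracted (\<not> s) s' v g r" "set v \<subseteq> K.L" "g \<in> carrier G"
  shows "contracted s s' v g (r + 1)"
proof (cases s; cases s')
  assume s: "s" "s'"
  then obtain a where a: "a \<in> A" "K.near v [Inr a, Inl (inv a \<otimes> g)] (r - 1)"
    using assms by auto
  then have "K.near v [Inl a, Inl (inv a \<otimes> g)] (r - 1 + 2)"
    using near_Inr_Inl[OF small, of v "[]" a "[Inl (inv a \<otimes> g)]" "r - 1"] assms by auto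
  moreover have "K.ev [Inl a, Inl (inv a \<otimes> g)] = K.ev [Inl g]"
    using a assms by (simp add: K.fp_eval_Inl_Inl_Cons m_assoc[symmetric])
  ultimately have "K.near v [Inl g] (r + 1)"
    by (rule K.near_cong[OF _ refl]) simp
  then show ?thesis
    using s by simp
next
  assume s: "s" "\<not> s'"
  from s assms consider b where "b \<in> A" "K.near v [Inr b] (r - d b g)"
    | b c where "b \<in> A" "c \<in> A" "K.near v [Inr b, Inl (inv b \<otimes> g \<otimes> inv c), Inr c] (r - 2)"
    by auto
  then show ?thesis
  proof cases
    \<comment> \<open>The only conjugated letter now stands at the right end and may stay there. The
      reserve \<open>d b g\<close> pays for inserting the correction
      \<open>g \<otimes> inv b\<close> in front of it.\<close>
    case 1
    have "d \<one> (g \<otimes> inv b) = d b g"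
      using 1 assms dist_right[of "inv b" b g] by simp
    then have "K.near [Inl \<one>] [Inl (g \<otimes> inv b)] (d b g)"
      using 1 assms by (intro K.near_letter) auto
    then have "K.near ([Inl \<one>] @ [Inr b]) ([Inl (g \<otimes> inv b)] @ [Inr b]) (d b g)"
      using 1 assms by (intro K.near_append[where r = "d b g" and r' = 0] K.near_refl) auto
    then have "K.near [Inr b] [Inl (g \<otimes> inv b), Inr b] (d b g)"
      by (rule K.near_cong) simp_all
    from K.near_trans[OF 1(2) this, of r] have "K.near v [Inl (g \<otimes> inv b), Inr b] r"
      using 1 assms by auto
    then show ?thesis
      using s 1 by auto
  next
    case 2
    then have "K.near v [Inl b, Inl (inv b \<otimes> g \<otimes> inv c), Inr c] (r - 2 + 2)"
      using near_Inr_Inl[OF small, of v "[]" b "[Inl (inv b \<otimes> g \<otimes> inv c), Inr c]" "r - 2"] assms by auto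
    moreover have "K.ev [Inl b, Inl (inv b \<otimes> g \<otimes> inv c), Inr c] = K.ev [Inl (g \<otimes> inv c), Inr c]"
      using 2 assms by (simp add: K.fp_eval_Inl_Inl_Cons m_assoc[symmetric])
    ultimately have "K.near v [Inl (g \<otimes> inv c), Inr c] r"
      by (rule K.near_cong[OF _ refl]) simp
    then show ?thesis
      using s 2 by auto
  qed
next
  assume s: "\<not> s" "s'"
  then have "K.near v [Inl g] r"
    using assms by simp
  then have "K.near v [Inr \<one>, Inl (inv \<one> \<otimes> g)] r"
    by (rule K.near_cong) (use assms in simp_all)
  then show ?thesis
    using s by (auto intro!: bexI[of _ \<one>])
next
  assume s: "\<not> s" "\<not> s'"
  then obtain a where a: "a \<in> A" "K.near v [Inl (g \<otimes> inv a), Inr a] (r - 1)"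
    using assms by auto
  from a(2) have "K.near v [Inr \<one>, Inl (inv \<one> \<otimes> g \<otimes> inv a), Inr a] (r + 1 - 2)"
    by (rule K.near_cong) (use assms in simp_all)
  then have "\<exists>b\<in>A. \<exists>c\<in>A. K.near v [Inr b, Inl (inv b \<otimes> g \<otimes> inv c), Inr c] (r + 1 - 2)"
    using a one_in_A by blast
  then show ?thesis
    using s by simp
qed

text \<open>Closes a region between paired letters. As the product is 1, the middle letter
  \<open>inv b \<otimes> inv c\<close> of G lies in A. Deleting it merges \<open>b\<close> and
  \<open>c\<close> into one letter of A, which is deleted next; the reserve of 2 covers
  both.\<close>

lemma contracted_one_near:
  assumes small: "\<And>a. a \<in> A \<Longrightarrow> d a \<one> \<le> 1"
    and "contracted s s v \<one> r" "set v \<subseteq> K.L"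
  shows "K.near v [] r"
proof (cases s)
  case True
  then show ?thesis
    using assms by (auto elim: K.near_cong)
next
  case False
  have letter: "K.near [Inr a] [] (d a \<one>)" if "a \<in> A" for a
  proof -
    have "K.near [Inr a] [Inr \<one>] (d a \<one>)"
      using that by (intro K.near_letter) auto
    then show ?thesis
      by (rule K.near_cong) simp_all
  qed
  from False assms consider b where "b \<in> A" "K.near v [Inr b] (r - d b \<one>)"
    | b c where "b \<in> A" "c \<in> A" "K.near v [Inr b, Inl (inv b \<otimes> \<one> \<otimes> inv c), Inr c] (r - 2)"
    by auto
  then show ?thesis
  proof cases
    case 1
    then show ?thesis
      using K.near_trans[OF 1(2) letter[OF 1(1)]] assms by auto
  next
    case 2
    let ?x = "inv b \<otimes> \<one> \<otimes> inv c"
    have x: "?x \<in> A"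
      using 2 by simp
    have "K.near [Inl ?x] [Inl \<one>] 1"
      using x small by (intro K.near_letter) auto
    then have "K.near ([Inl ?x] @ [Inr c]) ([Inl \<one>] @ [Inr c]) 1"
      using 2 x by (intro K.near_append[where r = 1 and r' = 0] K.near_refl) auto
    then have "K.near [Inr b, Inl ?x, Inr c] [Inr b, Inl \<one>, Inr c] 1"
      using 2 x near_Cons[of "[Inl ?x, Inr c]" "[Inl \<one>, Inr c]" 1 "Inr b"] by simp
    moreover have "K.ev [Inr b, Inl \<one>, Inr c] = K.ev [Inr (b \<otimes> c)]"
      using 2 K.fp_eval_Cons[of "Inr b" "[Inl \<one>, Inr c]"] K.fp_eval_Cons[of "Inr b" "[Inr c]"]
        K.fp_eval_Inr_Inr_Cons[of b c "[]"] by (simp del: fp_cons.simps)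
    ultimately have "K.near [Inr b, Inl ?x, Inr c] [Inr (b \<otimes> c)] 1"
      by (auto elim: K.near_cong)
    from K.near_trans[OF this letter[of "b \<otimes> c"], of 2]
    have "K.near [Inr b, Inl ?x, Inr c] [] 2"
      using 2 x small[of "b \<otimes> c"] by auto
    from K.near_trans[OF 2(3) this] show ?thesis
      using 2 x assms by auto
  qed
qed

lemma contracted_append:
  assumes "K.near u [] r" "contracted s s' v g q" "set u \<subseteq> K.L" "set v \<subseteq> K.L" "g \<in> carrier G"
  shows "contracted s s' (u @ v) g (r + q)"
proof -
  have *: "K.near (u @ v) w p'" if "K.near v w p" "set w \<subseteq> K.L" "r + p \<le> p'" for w p p'
    using K.near_append[OF assms(1) that(1)] that assms by auto
  show ?thesis
  proof (cases s; cases s')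
    assume s: "\<not> s" "\<not> s'"
    with assms(2) consider a where "a \<in> A" "K.near v [Inr a] (q - d a g)"
      | a b where "a \<in> A" "b \<in> A" "K.near v [Inr a, Inl (inv a \<otimes> g \<otimes> inv b), Inr b] (q - 2)"
      by auto
    then show ?thesis
    proof cases
      case 1
      then have "K.near (u @ v) [Inr a] (r + q - d a g)"
        by (intro *[OF 1(2)]) auto
      then show ?thesis using s 1 by auto
    next
      case 2
      then have "K.near (u @ v) [Inr a, Inl (inv a \<otimes> g \<otimes> inv b), Inr b] (r + q - 2)"
        using assms(5) by (intro *[OF 2(3)]) auto
      then show ?thesis using s 2 by auto
    qed
  next
    assume "s" "s'"
    then show ?thesis
      using assms by (auto intro!: *)
  next
    assume s: "s" "\<not> s'"
    then obtain a where "a \<in> A" "K.near v [Inl (g \<otimes> inv a), Inr a] (q - 1)"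
      using assms(2) by auto
    then show ?thesis
      using s assms(5) by (auto intro!: bexI[of _ a] *)
  next
    assume s: "\<not> s" "s'"
    then obtain a where "a \<in> A" "K.near v [Inr a, Inl (inv a \<otimes> g)] (q - 1)"
      using assms(2) by auto
    then show ?thesis
      using s assms(5) by (auto intro!: bexI[of _ a] *)
  qed
qed

lemma contracted_of_contracts:
  assumes small: "\<And>a. a \<in> A \<Longrightarrow> d a \<one> \<le> 1"
    and "contracts w g r" "path s w s'"
  shows "contracted s s' (label s w) g r"
  using assms(2,3)
proof (induction arbitrary: s s' rule: contracts.induct)
  case (Nil g r)
  \<comment> \<open>In G the trivial letter is changed to \<open>g\<close> at once. In the conjugate
    factor \<open>g\<close> may lie outside A, so the trivial letter is kept and
    \<open>d \<one> g\<close> is put in reserve.\<close>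
  have d: "d \<one> g \<le> r"
    using Nil by (simp add: dist_commute)
  have "K.near [Inl \<one>] [Inl g] r"
    using Nil d by (intro K.near_letter) auto
  then have "K.near [] [Inl g] r"
    by (rule K.near_cong) simp_all
  moreover have "K.near [] [Inr \<one>] (r - d \<one> g)"
    using d by (intro K.near_fp_eval_eq) auto
  ultimately show ?case
    using Nil by (cases s) (auto intro!: bexI[of _ \<one>])
next
  case (letter a w g r)
  then show ?case
    using contracted_letter[of s s' "label s w" g r a] label_in_L[of s w s']
      contracts_carrier[OF letter.hyps(2)] by auto
next
  case (delete w g r e)
  then show ?case
    using contracted_delete[OF small, of s s' "label (\<not> s) w" g r] label_in_L[of "\<not> s" w s']
      contracts_carrier[OF delete.hyps(1)] by auto
next
  case (pair u r w g q e)
  \<comment> \<open>Opposite letters change the state in opposite directions, so the interior starts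
    and ends in the same state, as \<open>contracted_one_near\<close> requires.\<close>
  then have paths: "path (\<not> s) u (\<not> s)" "path s w s'" and e: "e = s"
    by (auto simp: path_append)
  have "K.near (label (\<not> s) u) [] r"
    using small pair.IH(1)[OF paths(1)] label_in_L[OF paths(1)] by (rule contracted_one_near)
  then have "contracted s s' (label (\<not> s) u @ label s w) g (r + q)"
    using pair.IH(2)[OF paths(2)] label_in_L[OF paths(1)] label_in_L[OF paths(2)]
      contracts_carrier[OF pair.hyps(2)] by (rule contracted_append)
  then show ?case
    using paths e by (simp add: label_append)
qed

end

section \<open>Comparison of the two Graev metrics\<close>

context inv_metric_subgroup
begin

section \<open>The embedding does not increase distances\<close>

lemma conj_image_in_L: "set w \<subseteq> K.L \<Longrightarrow> set (conj_image w) \<subseteq> FZ.L"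
proof (induction w)
  case (Cons x w)
  then show ?case by (cases x) auto
qed simp

lemma conj_image_append: "conj_image (u @ w) = conj_image u @ conj_image w"
  by (simp add: conj_image_def)

lemma conj_image_fp_cons:
  assumes "x \<in> K.L" "set w \<subseteq> K.L"
  shows "FZ.ev (conj_image (fp_cons G GA x w)) = FZ.ev (conj_image (x # w))"
proof -
  have cong: "FZ.ev (x # u) = FZ.ev (x # v)" if "FZ.ev u = FZ.ev v" for x u v
    using that by (simp add: FZ.fp_eval_Cons)
  have one: "FZ.ev (Inl \<one> # u) = FZ.ev u" for u
    by (rule FZ.fp_eval_Inl_one_Cons)
  have zero: "FZ.ev (Inr 0 # u) = FZ.ev u" for u
    using FZ.fp_eval_Inr_one_Cons by simp
  have cancel: "FZ.ev (Inr m # Inr n # u) = FZ.ev u" if "m + n = 0" "set u \<subseteq> FZ.L" for m n u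
    using that FZ.fp_eval_Inr_Inr_Cons[of m n u] zero by simp
  have conj_one: "FZ.ev (Inr 1 # Inl \<one> # Inr (-1) # u) = FZ.ev u" if "set u \<subseteq> FZ.L" for u
    using that cong[OF one, of "Inr 1"] cancel[of 1 "-1" u] by simp
  show ?thesis
  proof (cases x)
    case (Inl a)
    show ?thesis
    proof (cases "\<exists>b v. w = Inl b # v")
      case True
      then obtain b v where w: "w = Inl b # v" by blast
      then have "FZ.ev (conj_image (x # w)) = FZ.ev (Inl (a \<otimes> b) # conj_image v)"
        using Inl assms conj_image_in_L[of v] by (simp add: FZ.fp_eval_Inl_Inl_Cons)
      then show ?thesis
        using Inl w one by (auto simp: one)
    next
      case False
      then show ?thesis
        using Inl one by (auto split: list.split sum.split)
    qed
  next
    case (Inr a)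
    show ?thesis
    proof (cases "\<exists>b v. w = Inr b # v")
      case True
      then obtain b v where w: "w = Inr b # v" by blast
      let ?v = "Inr (-1) # conj_image v"
      have ab: "a \<in> A" "b \<in> A" and v: "set ?v \<subseteq> FZ.L"
        using assms Inr w conj_image_in_L[of v] by auto
      have "FZ.ev (Inl a # Inr (-1) # Inr 1 # Inl b # ?v) = FZ.ev (Inl a # Inl b # ?v)"
        using ab v by (intro cong cancel) auto
      also have "\<dots> = FZ.ev (Inl (a \<otimes> b) # ?v)"
        using ab v by (intro FZ.fp_eval_Inl_Inl_Cons) auto
      finally have "FZ.ev (conj_image (x # w)) = FZ.ev (Inr 1 # Inl (a \<otimes> b) # ?v)"
        using Inr w by (auto intro: cong)
      moreover have "FZ.ev (Inr 1 # Inl \<one> # ?v) = FZ.ev (conj_image v)"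
        using v by (intro conj_one) auto
      moreover have "FZ.ev (Inr 1 # Inl \<one> # Inr (-1) # conj_image w) = FZ.ev (conj_image w)"
        using assms conj_image_in_L[of w] by (intro conj_one) auto
      ultimately show ?thesis
        using Inr w by (cases "a = \<one>"; cases "a \<otimes> b = \<one>") auto
    next
      case False
      have "FZ.ev (Inr 1 # Inl \<one> # Inr (-1) # conj_image w) = FZ.ev (conj_image w)"
        using assms conj_image_in_L[of w] by (intro conj_one) auto
      then show ?thesis
        using False Inr by (auto split: list.split sum.split)
    qed
  qed
qed

lemma conj_image_fp_eval: "set w \<subseteq> K.L \<Longrightarrow> FZ.ev (conj_image (K.ev w)) = FZ.ev (conj_image w)"
proof (induction w)
  case (Cons x w)
  have "set (K.ev w) \<subseteq> K.L"
    using Cons.prems K.reduced_fp_eval[of w] by (auto simp: K.reduced_def)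
  then have "FZ.ev (conj_image (K.ev (x # w))) = FZ.ev (conj_image [x] @ conj_image (K.ev w))"
    using Cons.prems conj_image_fp_cons[of x "K.ev w"]
    by (simp add: K.fp_eval_Cons flip: conj_image_append del: fp_cons.simps)
  also have "\<dots> = FZ.ev (conj_image [x] @ conj_image w)"
    using Cons by (simp add: FZ.fp_eval_append)
  finally show ?case
    by (simp flip: conj_image_append)
qed simp

lemma near_conj_image_pairs:
  "set ps \<subseteq> K.L \<times> K.L \<Longrightarrow>
    FZ.near (conj_image (map fst ps)) (conj_image (map snd ps)) (\<Sum>(x, y)\<leftarrow>ps. K.ld x y)"
proof (induction ps)
  case (Cons xy ps)
  obtain x y where xy: "xy = (x, y)" by (cases xy)
  then have L: "x \<in> K.L" "y \<in> K.L" "set (map fst ps) \<subseteq> K.L" "set (map snd ps) \<subseteq> K.L"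
    using Cons.prems by auto
  define g where "g = case_sum (\<lambda>g. g) (\<lambda>_ :: 'a. \<one>)"
  define k where "k = case_sum (\<lambda>_ :: 'a. \<one>) (\<lambda>a. a)"
  \<comment> \<open>Both letters are padded to the shape \<open>g t k t\<^sup>-\<^sup>1\<close>, so that the letters \<open>t\<close> face each other.\<close>
  define e where "e z = [Inl (g z), Inr (1 :: int), Inl (k z), Inr (-1)]" for z :: "'a + 'a"
  have gk: "g z \<in> carrier G" "k z \<in> carrier G" if "z \<in> K.L" for z
    using that by (cases z; simp add: g_def k_def)+
  have zero: "FZ.ev (Inr 0 # u) = FZ.ev u" for u
    using FZ.fp_eval_Inr_one_Cons by simp
  have e: "FZ.ev (e z) = FZ.ev (conj_image [z])" if "z \<in> K.L" for z
    using that FZ.fp_eval_Cons[of "Inr 1" "[Inl \<one>, Inr (-1)]"] FZ.fp_eval_Cons[of "Inr 1" "[Inr (-1)]"]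
      FZ.fp_eval_Cons[of "Inl _" "[Inr 1, Inl \<one>, Inr (-1)]"] FZ.fp_eval_Cons[of "Inl _" "[]"]
      FZ.fp_eval_Inr_Inr_Cons[of 1 "-1" "[]"] zero
    by (cases z) (simp_all add: e_def g_def k_def del: fp_cons.simps)
  have "FZ.near (e x) (e y) (K.ld x y)"
    unfolding FZ.near_def
    using L gk dist_self
    by (intro exI[of _ "zip (e x) (e y)"], cases x; cases y)
      (auto simp: e_def g_def k_def int_dist_def dist_commute)
  then have "FZ.near (conj_image [x]) (conj_image [y]) (K.ld x y)"
    by (rule FZ.near_cong) (simp_all only: e L order_refl)
  then have "FZ.near (conj_image [x] @ conj_image (map fst ps)) (conj_image [y] @ conj_image (map snd ps))
      (\<Sum>(x, y)\<leftarrow>xy # ps. K.ld x y)"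
    using Cons.IH
  proof (rule FZ.near_append)
    show "set ps \<subseteq> K.L \<times> K.L"
      using Cons.prems by simp
    show "set (conj_image [x]) \<subseteq> FZ.L" "set (conj_image [y]) \<subseteq> FZ.L"
      using L conj_image_in_L[of "[x]"] conj_image_in_L[of "[y]"] by auto
    show "set (conj_image (map fst ps)) \<subseteq> FZ.L" "set (conj_image (map snd ps)) \<subseteq> FZ.L"
      using L(3,4) conj_image_in_L by blast+
  qed (simp add: xy)
  then show ?case
    by (simp add: xy flip: conj_image_append)
qed (simp add: FZ.near_refl)

lemma in_fp_carrier:
  assumes "f \<in> fp_carrier G GA"
  shows "K.reduced f" "set f \<subseteq> K.L" "K.ev f = f"
    "set (conj_image f) \<subseteq> FZ.L" "FZ.ev (conj_image f) = conj_image f" "conj_embed G f = conj_image f"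
proof -
  show "K.reduced f"
    using assms K.fp_carrier_iff_reduced by blast
  then show "set f \<subseteq> K.L" "K.ev f = f"
    by (auto simp: K.reduced_def K.fp_eval_reduced)
  then show "set (conj_image f) \<subseteq> FZ.L"
    using conj_image_in_L by blast
  show "FZ.ev (conj_image f) = conj_image f"
    using \<open>K.reduced f\<close> by (intro FZ.fp_eval_reduced conj_image_reduced)
  then show "conj_embed G f = conj_image f"
    by (simp add: conj_embed_eq)
qed

lemma graev_conj_embed_le:
  assumes "f1 \<in> fp_carrier G GA" "f2 \<in> fp_carrier G GA"
  shows "graev G integer_group d int_dist (conj_embed G f1) (conj_embed G f2) \<le> graev G GA d d f1 f2"
proof (rule K.le_graev)
  note f1 = in_fp_carrier[OF assms(1)] and f2 = in_fp_carrier[OF assms(2)]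
  fix ps
  assume ps: "set ps \<subseteq> K.L \<times> K.L" "K.ev (map fst ps) = f1" "K.ev (map snd ps) = f2"
  from near_conj_image_pairs[OF ps(1)]
  have "FZ.near (conj_image f1) (conj_image f2) (\<Sum>(x, y)\<leftarrow>ps. K.ld x y)"
    using conj_image_fp_eval K.set_map_fst_snd[OF ps(1)] ps(2,3) by (metis FZ.near_cong order_refl)
  then show "graev G integer_group d int_dist (conj_embed G f1) (conj_embed G f2) \<le> (\<Sum>(x, y)\<leftarrow>ps. K.ld x y)"
    unfolding f1(6) f2(6) using f1(5) f2(5) by (rule FZ.graev_le)
qed (use in_fp_carrier assms in blast)+

section \<open>The embedding does not decrease distances if A is small\<close>

lemma graev_conj_embed_ge:
  assumes small: "\<And>a. a \<in> A \<Longrightarrow> d a \<one> \<le> 1"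
    and "f1 \<in> fp_carrier G GA" "f2 \<in> fp_carrier G GA"
  shows "graev G GA d d f1 f2 \<le> graev G integer_group d int_dist (conj_embed G f1) (conj_embed G f2)"
proof -
  note f1 = in_fp_carrier[OF assms(2)] and f2 = in_fp_carrier[OF assms(3)]
  let ?p = "\<lambda>f. expand (conj_image f)"
  have "graev G GA d d f1 f2 \<le> r" if near: "FZ.near (conj_image f1) (conj_image f2) r" for r
  proof -
    have "contracts (inv_path (?p f2) @ ?p f1) \<one> r"
      using contracts_of_near[OF near] f1 f2 by simp
    moreover have p: "path True (inv_path (?p f2)) True" "label True (inv_path (?p f2)) = K.inv_word f2"
      "path True (?p f1) True" "label True (?p f1) = f1"
      using path_conj_image f1(2) f2(2) path_inv_path by force+
    ultimately have "contracted True True (label True (inv_path (?p f2) @ ?p f1)) \<one> r"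
      using small by (intro contracted_of_contracts) (auto simp: path_append)
    then have near': "K.near (K.inv_word f2 @ f1) [Inl \<one>] r"
      by (simp add: label_append[OF p(1)] p)
    have inv_f2: "set (K.inv_word f2) \<subseteq> K.L"
      using f2(2) by (rule K.inv_word_in_L)
    \<comment> \<open>Multiplying by \<open>f2\<close> on the left turns closeness of
      \<open>f2^-1 f1\<close> to 1 into closeness of \<open>f1\<close> to \<open>f2\<close>.\<close>
    have "K.near (f2 @ K.inv_word f2 @ f1) (f2 @ [Inl \<one>]) r"
      using K.near_append[OF K.near_refl[OF f2(2), of 0] near'] f1 f2 inv_f2 by simp
    moreover have "K.ev ((f2 @ K.inv_word f2) @ f1) = K.ev ([] @ f1)"
      using f1 f2 inv_f2 by (intro K.fp_eval_append_cong) (auto simp: K.fp_eval_inv_word_right)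
    moreover have "K.ev (f2 @ [Inl \<one>]) = K.ev (f2 @ [])"
      by (simp only: K.fp_eval_append K.fp_eval_Inl_one_Cons)
    ultimately have "K.near f1 f2 r"
      by (auto elim: K.near_cong)
    then show ?thesis
      using f1 f2 by (intro K.graev_le)
  qed
  then show ?thesis
    unfolding f1(6) f2(6) using f1 f2
    by (intro FZ.le_graev) (auto simp: FZ.near_def)
qed

text \<open>The homomorphism from the free product onto \<open>G \<times> A\<close> is Lipschitz for the \<open>l\<^sub>1\<close>-metric.\<close>

fun fst_proj :: "('a + 'a) list \<Rightarrow> 'a" where
  "fst_proj [] = \<one>"
| "fst_proj (Inl a # w) = a \<otimes> fst_proj w"
| "fst_proj (Inr a # w) = fst_proj w"

fun snd_proj :: "('a + 'a) list \<Rightarrow> 'a" where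
  "snd_proj [] = \<one>"
| "snd_proj (Inl a # w) = snd_proj w"
| "snd_proj (Inr a # w) = a \<otimes> snd_proj w"

lemma proj_carrier:
  "set w \<subseteq> K.L \<Longrightarrow> fst_proj w \<in> carrier G" "set w \<subseteq> K.L \<Longrightarrow> snd_proj w \<in> carrier G"
  by (induction w rule: fst_proj.induct) auto

lemma proj_fp_cons:
  assumes "set (x # w) \<subseteq> K.L"
  shows "fst_proj (fp_cons G GA x w) = fst_proj (x # w)" "snd_proj (fp_cons G GA x w) = snd_proj (x # w)"
proof -
  have inverse: "z = a \<otimes> (b \<otimes> z)" if "a \<otimes> b = \<one>" "a \<in> carrier G" "b \<in> carrier G" "z \<in> carrier G" for a b z
    using that by (simp flip: m_assoc)
  show "fst_proj (fp_cons G GA x w) = fst_proj (x # w)" "snd_proj (fp_cons G GA x w) = snd_proj (x # w)"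
    using assms proj_carrier[of w] proj_carrier[of "tl w"]
    by (cases x; cases w rule: list.exhaust; cases "hd w"; auto simp: m_assoc intro!: inverse)+
qed

lemma proj_fp_eval:
  "set w \<subseteq> K.L \<Longrightarrow> fst_proj (K.ev w) = fst_proj w \<and> snd_proj (K.ev w) = snd_proj w"
proof (induction w)
  case (Cons x w)
  have "set (x # K.ev w) \<subseteq> K.L"
    using Cons.prems K.reduced_fp_eval[of w] by (auto simp: K.reduced_def)
  then show ?case
    using Cons proj_fp_cons by (cases x) (simp_all add: K.fp_eval_Cons del: fp_cons.simps)
qed simp

lemma dist_mult_le:
  assumes "a \<in> carrier G" "b \<in> carrier G" "x \<in> carrier G" "y \<in> carrier G"
  shows "d (a \<otimes> x) (b \<otimes> y) \<le> d a b + d x y"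
  using assms dist_triangle[of "a \<otimes> x" "b \<otimes> x" "b \<otimes> y"] by (simp add: dist_left dist_right)

lemma dist_proj_le:
  "set ps \<subseteq> K.L \<times> K.L \<Longrightarrow>
    d (fst_proj (map fst ps)) (fst_proj (map snd ps)) + d (snd_proj (map fst ps)) (snd_proj (map snd ps))
    \<le> (\<Sum>(x, y)\<leftarrow>ps. K.ld x y)"
proof (induction ps)
  case (Cons xy ps)
  obtain x y where xy: "xy = (x, y)" by (cases xy)
  let ?u = "map fst ps" and ?v = "map snd ps"
  have L: "x \<in> K.L" "y \<in> K.L" "set ?u \<subseteq> K.L" "set ?v \<subseteq> K.L"
    using Cons.prems xy by auto
  have Cons_eq: "fst_proj (z # w) = fst_proj [z] \<otimes> fst_proj w" "snd_proj (z # w) = snd_proj [z] \<otimes> snd_proj w"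
    if "z \<in> K.L" "set w \<subseteq> K.L" for z w
    using that proj_carrier[of w] by (cases z; simp)+
  have "d (fst_proj (x # ?u)) (fst_proj (y # ?v)) \<le> d (fst_proj [x]) (fst_proj [y]) + d (fst_proj ?u) (fst_proj ?v)"
    "d (snd_proj (x # ?u)) (snd_proj (y # ?v)) \<le> d (snd_proj [x]) (snd_proj [y]) + d (snd_proj ?u) (snd_proj ?v)"
    using L by (simp_all only: Cons_eq) (intro dist_mult_le proj_carrier; simp)+
  moreover have "d (fst_proj [x]) (fst_proj [y]) + d (snd_proj [x]) (snd_proj [y]) = K.ld x y"
    using L by (cases x; cases y) (auto simp: dist_self dist_commute)
  moreover have "d (fst_proj ?u) (fst_proj ?v) + d (snd_proj ?u) (snd_proj ?v) \<le> (\<Sum>(x, y)\<leftarrow>ps. K.ld x y)"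
    using Cons by simp
  ultimately show ?case
    by (simp add: xy del: fst_proj.simps snd_proj.simps)
qed (simp add: dist_self)

text \<open>The two words project to (a,1) and (1,a). They are evaluated first because a single
  trivial letter is not a normal form.\<close>

lemma graev_Inl_Inr_ge:
  assumes "a \<in> A"
  shows "2 * d a \<one> \<le> graev G GA d d (K.ev [Inl a]) (K.ev [Inr a])"
proof (rule K.le_graev)
  fix ps
  assume ps: "set ps \<subseteq> K.L \<times> K.L" "K.ev (map fst ps) = K.ev [Inl a]" "K.ev (map snd ps) = K.ev [Inr a]"
  have "fst_proj (K.ev [Inl a]) = a" "snd_proj (K.ev [Inl a]) = \<one>"
    "fst_proj (K.ev [Inr a]) = \<one>" "snd_proj (K.ev [Inr a]) = a"
    using assms proj_fp_eval[of "[Inl a]"] proj_fp_eval[of "[Inr a]"] by simp_all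
  then have "fst_proj (map fst ps) = a" "snd_proj (map fst ps) = \<one>"
    "fst_proj (map snd ps) = \<one>" "snd_proj (map snd ps) = a"
    using proj_fp_eval[OF K.set_map_fst_snd(1)[OF ps(1)]] proj_fp_eval[OF K.set_map_fst_snd(2)[OF ps(1)]]
    unfolding ps(2,3) by simp_all
  then show "2 * d a \<one> \<le> (\<Sum>(x, y)\<leftarrow>ps. K.ld x y)"
    using dist_proj_le[OF ps(1)] assms by (simp add: dist_commute)
qed (use assms in \<open>auto simp: K.fp_eval_Cons\<close>)

lemma graev_conj_embed_Inl_Inr_le:
  assumes "a \<in> A"
  shows "graev G integer_group d int_dist (conj_embed G [Inl a]) (conj_embed G [Inr a]) \<le> 2"
proof -
  have "FZ.near [Inl a] [Inr 1, Inl a, Inr (-1)] 2"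
    unfolding FZ.near_def using assms
    \<comment> \<open>The letters \<open>t\<close> and \<open>t^-1\<close> face identities at cost 1
      each, and \<open>a\<close> faces itself.\<close>
    by (intro exI[of _ "[(Inl \<one>, Inr 1), (Inl a, Inl a), (Inl \<one>, Inr (-1))]"])
      (auto simp: dist_self int_dist_def FZ.fp_eval_Cons)
  then have "FZ.near (FZ.ev [Inl a]) (FZ.ev [Inr 1, Inl a, Inr (-1)]) 2"
    using assms by (auto elim!: FZ.near_cong intro!: FZ.fp_eval_reduced[symmetric] FZ.reduced_fp_eval)
  then show ?thesis
    using assms unfolding conj_embed_eq
    by (auto intro!: FZ.graev_le FZ.fp_eval_reduced FZ.reduced_fp_eval)
qed

lemma diam_le_one_iff: "diam d A \<le> 1 \<longleftrightarrow> (\<forall>a\<in>A. d a \<one> \<le> 1)"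
proof
  assume "diam d A \<le> 1"
  then show "\<forall>a\<in>A. d a \<one> \<le> 1"
    using one_in_A unfolding diam_def SUP_le_iff one_ereal_def by auto
next
  assume small: "\<forall>a\<in>A. d a \<one> \<le> 1"
  have "d a b \<le> 1" if "a \<in> A" "b \<in> A" for a b
    using small that dist_right[of "inv b" a b] by (metis in_carrier inv_in_A mult_in_A r_inv)
  then show "diam d A \<le> 1"
    unfolding diam_def SUP_le_iff one_ereal_def by auto
qed

end

theorem mainTheorem10:
  fixes G :: "('a, 'm) monoid_scheme" and d :: "'a \<Rightarrow> 'a \<Rightarrow> real" and A :: "'a set"
  assumes "group G" and "inv_metric G d" and "subgroup A G" and "metric_closed G d A"
  shows "(\<forall>f1\<in>fp_carrier G (G\<lparr>carrier := A\<rparr>). \<forall>f2\<in>fp_carrier G (G\<lparr>carrier := A\<rparr>).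
            graev G integer_group d int_dist (conj_embed G f1) (conj_embed G f2)
            = graev G (G\<lparr>carrier := A\<rparr>) d d f1 f2)
         \<longleftrightarrow> diam d A \<le> 1"
    (is "?isometric \<longleftrightarrow> _")
proof -
  interpret inv_metric_subgroup G d A
    using assms by (intro inv_metric_subgroup.intro inv_metric_group.intro
        inv_metric_group_axioms.intro inv_metric_subgroup_axioms.intro)
  have "d a \<one>\<^bsub>G\<^esub> \<le> 1" if ?isometric "a \<in> A" for a
  \<comment> \<open>For trivial \<open>a\<close> the one-letter words are not elements of the free
    product, and the isometry says nothing about them.\<close>
  proof (cases "a = \<one>\<^bsub>G\<^esub>")
    case True
    then show ?thesis using dist_self by simp
  next
    case False
    then have f: "K.reduced [Inl a]" "K.reduced [Inr a]"
      using that by (auto simp: K.reduced_Cons)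
    then have "graev G integer_group d int_dist (conj_embed G [Inl a]) (conj_embed G [Inr a])
        = graev G GA d d [Inl a] [Inr a]"
      using that(1) K.fp_carrier_iff_reduced by blast
    then show ?thesis
      using graev_Inl_Inr_ge[OF that(2)] graev_conj_embed_Inl_Inr_le[OF that(2)] f
      by (simp add: K.fp_eval_reduced)
  qed
  moreover have ?isometric if "\<forall>a\<in>A. d a \<one>\<^bsub>G\<^esub> \<le> 1"
    using that graev_conj_embed_le graev_conj_embed_ge by (intro ballI antisym) auto
  ultimately show ?thesis
    unfolding diam_le_one_iff by blast
qed

end
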